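(* Let $d\ge3$. For every integer $N\ge1$ there exists a coupling $\mathbb Q_N$ of the zero-average Gaussian free field $\Psi_{\mathbb T^d_N}$ on $\mathbb T^d_N$ and the Gaussian free field $\varphi_{\mathbb Z^d}$ on $\mathbb Z^d$ (i.e. a probability measure carrying both fields with the correct marginal laws) such that the following holds. For every $\delta\in(\tfrac12,1)$, $\varepsilon>0$ and $h\in\mathbb R$ there are constants $c_\delta,c'_\delta>0$, depending only on $\delta$ and $d$ (not on $N$, $\varepsilon$ or $h$), such that for all $N \geq 1$ $$\mathbb Q_N\Big[\pi_N\big(E_{\varphi_{\mathbb Z^d}}^{\ge h+\varepsilon}\cap\mathcal B_N^\delta\big)\subseteq\big(E_{\Psi_{\mathbb T^d_N}}^{\ge h}\cap B_N^\delta\big)\subseteq\pi_N\big(E_{\varphi_{\mathbb Z^d}}^{\ge h-\varepsilon}\cap\mathcal B_N^\delta\big)\Big]\ge1-4N^d\exp\big(-c_\delta\,\varepsilon^2N^{c'_\delta}\big).$$ In particular, for all $\delta\in(\tfrac12,1)$, $\varepsilon>0$ and $h\in\mathbb R$, $$\lim_{N\to\infty}\mathbb Q_N\Big[\pi_N\big(E_{\varphi_{\mathbb Z^d}}^{\ge h+\varepsilon}\cap\mathcal B_N^\delta\big)\subseteq\big(E_{\Psi_{\mathbb T^d_N}}^{\ge h}\cap B_N^\delta\big)\subseteq\pi_N\big(E_{\varphi_{\mathbb Z^d}}^{\ge h-\varepsilon}\cap\mathcal B_N^\delta\big)\Big]=1.$$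
   Context: $\mathbb T^d_N=(\mathbb Z/N\mathbb Z)^d$ is the discrete torus and $\mathbb Z^d$ the integer lattice, both with nearest-neighbour graph structure, $d\ge3$ fixed. $\pi_N:\mathbb Z^d\to\mathbb T^d_N$ is the canonical projection. Simple random walk moves at each step to $x\pm e_i$ (modulo $N$ on the torus) with probability $\frac1{2d}$ each; $P_x^{\mathbb T^d_N}$, $P_x^{\mathbb Z^d}$ are its laws started at $x$; $(X_k)_{k\ge0}$ is the discrete-time walk and $(\overline X_t)_{t\ge0}$ the continuous-time walk with i.i.d. Exp(1) holding times. Zero-average Green function: $G_{\mathbb T^d_N}(x,y)=\int_0^\infty\big(P_x^{\mathbb T^d_N}[\overline X_t=y]-\frac1{N^d}\big)dt$, $x,y\in\mathbb T^d_N$. The zero-average Gaussian free field $(\Psi_{\mathbb T^d_N}(x))_{x\in\mathbb T^d_N}$ is the centered Gaussian field with covariance $G_{\mathbb T^d_N}(\cdot,\cdot)$. Green function on $\mathbb Z^d$: $g_{\mathbb Z^d}(x,y)=\sum_{k\ge0}P_x^{\mathbb Z^d}[X_k=y]$. The Gaussian free field $(\varphi_{\mathbb Z^d}(x))_{x\in\mathbb Z^d}$ is the centered Gaussian field with covariance $g_{\mathbb Z^d}(\cdot,\cdot)$. Level sets: $E_{\Psi_{\mathbb T^d_N}}^{\ge h}=\{x\in\mathbb T^d_N:\Psi_{\mathbb T^d_N}(x)\ge h\}$ and $E_{\varphi_{\mathbb Z^d}}^{\ge h}=\{x\in\mathbb Z^d:\varphi_{\mathbb Z^d}(x)\ge h\}$,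 $h\in\mathbb R$. Boxes: $\mathcal B_N^\delta=\big(-\frac{N-N^\delta-2}2,\frac{N-N^\delta-2}2\big]^d\cap\mathbb Z^d$ and $B_N^\delta=\pi_N(\mathcal B_N^\delta)\subseteq\mathbb T^d_N$ (possibly empty for small $N$). *)

theory Defs
  imports "HOL-Probability.Probability"
begin

text \<open>
  The lattice \<open>\<int>\<^sup>d\<close> is the type \<open>int ^ 'd\<close>, so that \<open>d = CARD('d)\<close>. As \<open>N\<close> varies, the torus
  \<open>(\<int>/N\<int>)\<^sup>d\<close> is represented by its canonical representatives in \<open>{0, ..., N-1}\<^sup>d\<close>.
\<close>

definition torus :: "nat \<Rightarrow> (int ^ 'd) set" where
  "torus N = {x. \<forall>i. 0 \<le> x $ i \<and> x $ i < int N}"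

definition proj :: "nat \<Rightarrow> int ^ 'd \<Rightarrow> int ^ 'd" where
  "proj N x = (\<chi> i. x $ i mod int N)"

definition unit_steps :: "(int ^ 'd) set" where
  "unit_steps = range (\<lambda>i. axis i 1) \<union> range (\<lambda>i. - axis i 1)"

definition increments :: "(nat \<Rightarrow> int ^ 'd) measure" where
  "increments = (\<Pi>\<^sub>M k\<in>UNIV. measure_pmf (pmf_of_set unit_steps))"

definition holding_times :: "(nat \<Rightarrow> real) measure" where
  "holding_times = (\<Pi>\<^sub>M k\<in>UNIV. density lborel (exponential_density 1))"

primrec srw_lattice :: "int ^ 'd \<Rightarrow> (nat \<Rightarrow> int ^ 'd) \<Rightarrow> nat \<Rightarrow> int ^ 'd" where
  "srw_lattice x \<xi> 0 = x"
| "srw_lattice x \<xi> (Suc k) = srw_lattice x \<xi> k + \<xi> k"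

primrec srw_torus :: "nat \<Rightarrow> int ^ 'd \<Rightarrow> (nat \<Rightarrow> int ^ 'd) \<Rightarrow> nat \<Rightarrow> int ^ 'd" where
  "srw_torus N x \<xi> 0 = x"
| "srw_torus N x \<xi> (Suc k) = proj N (srw_torus N x \<xi> k + \<xi> k)"

text \<open>
  The number of jumps up to time \<open>t\<close>: jump number \<open>n + 1\<close> takes place at time
  \<open>\<tau> 0 + ... + \<tau> n\<close>. The set is almost surely finite.
\<close>

definition jump_count :: "(nat \<Rightarrow> real) \<Rightarrow> real \<Rightarrow> nat" where
  "jump_count \<tau> t = card {n. (\<Sum>j\<le>n. \<tau> j) \<le> t}"

definition ctrw_torus :: "nat \<Rightarrow> int ^ 'd \<Rightarrow> (nat \<Rightarrow> int ^ 'd) \<times> (nat \<Rightarrow> real) \<Rightarrow> real \<Rightarrow> int ^ 'd" where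
  "ctrw_torus N x \<omega> t = srw_torus N x (fst \<omega>) (jump_count (snd \<omega>) t)"

definition green_lattice :: "int ^ 'd \<Rightarrow> int ^ 'd \<Rightarrow> real" where
  "green_lattice x y =
     (\<Sum>k. measure increments {\<xi> \<in> space increments. srw_lattice x \<xi> k = y})"

definition green_torus :: "nat \<Rightarrow> int ^ 'd \<Rightarrow> int ^ 'd \<Rightarrow> real" where
  "green_torus N x y =
     (LBINT t:{0..}.
        measure (increments \<Otimes>\<^sub>M holding_times)
          {\<omega> \<in> space (increments \<Otimes>\<^sub>M holding_times). ctrw_torus N x \<omega> t = y}
        - 1 / real N ^ CARD('d))"

text \<open>
  Point masses count as Gaussian laws: the covariance \<open>green_torus N\<close> is degenerate, since the
  field has zero average over the torus.
\<close>

definition gaussian_law :: "real measure \<Rightarrow> bool" where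
  "gaussian_law \<mu> \<longleftrightarrow>
     (\<exists>m. \<mu> = return borel m) \<or> (\<exists>m. \<exists>\<sigma>>0. \<mu> = density lborel (normal_density m \<sigma>))"

definition centered_gaussian_field ::
    "'w measure \<Rightarrow> 'i set \<Rightarrow> ('i \<Rightarrow> 'w \<Rightarrow> real) \<Rightarrow> ('i \<Rightarrow> 'i \<Rightarrow> real) \<Rightarrow> bool" where
  "centered_gaussian_field M I X K \<longleftrightarrow>
     prob_space M \<and>
     (\<forall>x\<in>I. X x \<in> borel_measurable M) \<and>
     (\<forall>A a. finite A \<and> A \<subseteq> I \<longrightarrow> gaussian_law (distr M borel (\<lambda>\<omega>. \<Sum>x\<in>A. a x * X x \<omega>))) \<and>
     (\<forall>x\<in>I. (\<integral>\<omega>. X x \<omega> \<partial>M) = 0) \<and>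
     (\<forall>x\<in>I. \<forall>y\<in>I. (\<integral>\<omega>. X x \<omega> * X y \<omega> \<partial>M) = K x y)"

definition GFF_coupling :: "nat \<Rightarrow> ((int ^ 'd \<Rightarrow> real) \<times> (int ^ 'd \<Rightarrow> real)) measure \<Rightarrow> bool" where
  "GFF_coupling N Q \<longleftrightarrow>
     sets Q = sets ((\<Pi>\<^sub>M x\<in>torus N. borel) \<Otimes>\<^sub>M (\<Pi>\<^sub>M x\<in>UNIV. borel)) \<and>
     centered_gaussian_field Q (torus N) (\<lambda>x \<omega>. fst \<omega> x) (green_torus N) \<and>
     centered_gaussian_field Q UNIV (\<lambda>x \<omega>. snd \<omega> x) green_lattice"

definition level_set_torus :: "nat \<Rightarrow> (int ^ 'd \<Rightarrow> real) \<Rightarrow> real \<Rightarrow> (int ^ 'd) set" where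
  "level_set_torus N \<psi> h = {x \<in> torus N. \<psi> x \<ge> h}"

definition level_set_lattice :: "(int ^ 'd \<Rightarrow> real) \<Rightarrow> real \<Rightarrow> (int ^ 'd) set" where
  "level_set_lattice \<phi> h = {x. \<phi> x \<ge> h}"

definition box_lattice :: "nat \<Rightarrow> real \<Rightarrow> (int ^ 'd) set" where
  "box_lattice N \<delta> =
     {x. \<forall>i. - ((real N - real N powr \<delta> - 2) / 2) < real_of_int (x $ i) \<and>
             real_of_int (x $ i) \<le> (real N - real N powr \<delta> - 2) / 2}"

definition box_torus :: "nat \<Rightarrow> real \<Rightarrow> (int ^ 'd) set" where
  "box_torus N \<delta> = proj N ` box_lattice N \<delta>"

definition level_sets_sandwiched ::
    "nat \<Rightarrow> real \<Rightarrow> real \<Rightarrow> real \<Rightarrow> (int ^ 'd \<Rightarrow> real) \<Rightarrow> (int ^ 'd \<Rightarrow> real) \<Rightarrow> bool" where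
  "level_sets_sandwiched N \<delta> \<epsilon> h \<psi> \<phi> \<longleftrightarrow>
     proj N ` (level_set_lattice \<phi> (h + \<epsilon>) \<inter> box_lattice N \<delta>)
       \<subseteq> level_set_torus N \<psi> h \<inter> box_torus N \<delta> \<and>
     level_set_torus N \<psi> h \<inter> box_torus N \<delta>
       \<subseteq> proj N ` (level_set_lattice \<phi> (h - \<epsilon>) \<inter> box_lattice N \<delta>)"

end

theory Submission
  imports Defs "HOL-Real_Asymp.Real_Asymp"
begin

text \<open>
  Write \<open>P\<close> for the transition operator of the walk. On \<open>[-1, 1)\<close>
  \<open>1 / (1 - \<lambda>) = 1/2 + 1/2 * (\<Sum>k. (\<lambda> ^ k + \<lambda> ^ (k + 1))\<^sup>2)\<close>,
  so the Green operator \<open>(1 - P)\<^sup>-\<^sup>1\<close> is half the identity plus half the sum of the squares of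
  \<open>P ^ k + P ^ (k + 1)\<close>, on the lattice and, after subtracting the projection to constants, on
  the torus (\<open>green_lattice_eq\<close>, \<open>green_torus_eq\<close>). For the time integral defining the torus Green
  function, the number of jumps is Poisson distributed, so that the Fourier mode with eigenvalue \<open>\<lambda>\<close>
  decays like \<open>exp (- (1 - \<lambda>) * t)\<close> and integrates to \<open>1 / (1 - \<lambda>)\<close>. Both fields can therefore be thought of as
  sums over \<open>k\<close> of the kernels of \<open>P ^ k + P ^ (k + 1)\<close> applied to independent white noises.
  The coupling uses the same white noise for both: the torus field reads the lattice noise inside
  the centred box of side \<open>N\<close>, whose sites represent the torus. It does not depend on \<open>\<delta>\<close>.

  Let \<open>x\<close> be in \<open>box_lattice N \<delta>\<close>. Number the kernels by their range \<open>k\<close>; the outside of the centred box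
  is further than \<open>N powr \<delta> / 2\<close> from \<open>x\<close>. So for \<open>k \<le> N powr \<delta> / 2\<close> lattice and torus
  see the same kernel, and only the subtracted constant, of squared norm at most \<open>4 / N ^ d\<close>, remains
  (\<open>feature_dist_short_time\<close>). For larger \<open>k\<close> each of the two contributions to the variance is
  \<open>O(k powr (-5/4))\<close>, uniformly in \<open>N\<close> (\<open>gram_diag_bound\<close>). This is where \<open>d \<ge> 3\<close> enters, through a
  bound on the Fourier series of the torus kernel (\<open>heat_kernel_bound\<close>); the exponent
  \<open>5/4\<close> is an arbitrary choice between \<open>1\<close> and \<open>3/2\<close>. The lattice inherits the bound from large tori. Altogether the
  difference of the fields at \<open>x\<close> is a centred Gaussian variable with variance
  \<open>O(N powr (- \<delta> / 8))\<close> (\<open>coupled_variance_bound\<close>), and a Gaussian tail estimate with a union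
  bound over the at most \<open>N ^ d\<close> sites of the box gives the theorem, since the level sets are sandwiched
  when the fields differ by at most \<open>\<epsilon>\<close> on the box.

  White noise itself appears only in the construction of a Gaussian field with a prescribed
  positive semidefinite covariance (\<open>centered_gaussian_field_exists\<close>). The coupling is this field for
  \<open>joint_kernel\<close>, the sum over \<open>k\<close> of the inner products of the kernels just described; as a
  sum of Gram matrices it is positive semidefinite.
\<close>

section \<open>Gaussian fields with a prescribed covariance\<close>

definition psd_kernel :: "('i \<Rightarrow> 'i \<Rightarrow> real) \<Rightarrow> bool" where
  "psd_kernel K \<longleftrightarrow> (\<forall>a b. K a b = K b a) \<and>
     (\<forall>A c. finite A \<longrightarrow> 0 \<le> (\<Sum>a\<in>A. \<Sum>b\<in>A. c a * c b * K a b))"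

lemma psd_kernel_sym: "psd_kernel K \<Longrightarrow> K a b = K b a"
  by (auto simp: psd_kernel_def)

lemma psd_kernel_form_nonneg:
  "psd_kernel K \<Longrightarrow> finite A \<Longrightarrow> 0 \<le> (\<Sum>a\<in>A. \<Sum>b\<in>A. c a * c b * K a b)"
  by (auto simp: psd_kernel_def)

lemma psd_kernel_diag_nonneg: "psd_kernel K \<Longrightarrow> 0 \<le> K a a"
  using psd_kernel_form_nonneg[of K "{a}" "\<lambda>_. 1"] by simp

text \<open>
  The form is evaluated at the coefficients \<open>c\<close> with \<open>t\<close> added at \<open>e\<close>, which may or may not lie in \<open>A\<close>.
\<close>

lemma psd_kernel_form_add_point:
  assumes "psd_kernel K" "finite A"
  shows "0 \<le> (\<Sum>a\<in>A. \<Sum>b\<in>A. c a * c b * K a b) + 2 * t * (\<Sum>a\<in>A. c a * K a e) + t\<^sup>2 * K e e"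
proof -
  define B where "B = insert e A"
  define c0 where "c0 a = (if a \<in> A then c a else 0)" for a
  define c' where "c' a = c0 a + (if a = e then t else 0)" for a
  have fB: "finite B" and AB: "A \<subseteq> B" and eB: "e \<in> B" using assms by (auto simp: B_def)
  have ext: "(\<Sum>a\<in>B. c0 a * f a) = (\<Sum>a\<in>A. c a * f a)" for f :: "'a \<Rightarrow> real"
    by (rule sum.mono_neutral_cong_right) (use fB AB in \<open>auto simp: c0_def\<close>)
  have exp: "(\<Sum>a\<in>B. c' a * f a) = (\<Sum>a\<in>A. c a * f a) + t * f e" for f :: "'a \<Rightarrow> real"
  proof -
    have "(\<Sum>a\<in>B. c' a * f a) = (\<Sum>a\<in>B. c0 a * f a) + (\<Sum>a\<in>B. if a = e then t * f a else 0)"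
      by (simp add: c'_def distrib_right sum.distrib[symmetric] if_distrib[of "\<lambda>x. x * _"] cong: if_cong)
    then show ?thesis using fB eB by (simp add: ext sum.delta)
  qed
  have "0 \<le> (\<Sum>a\<in>B. \<Sum>b\<in>B. c' a * c' b * K a b)"
    using psd_kernel_form_nonneg[OF assms(1) fB] .
  also have "\<dots> = (\<Sum>a\<in>B. c' a * (\<Sum>b\<in>B. c' b * K a b))"
    by (simp add: sum_distrib_left mult.assoc)
  also have "\<dots> = (\<Sum>a\<in>A. c a * ((\<Sum>b\<in>A. c b * K a b) + t * K a e))
                 + t * ((\<Sum>b\<in>A. c b * K e b) + t * K e e)"
    by (simp add: exp)
  also have "(\<Sum>b\<in>A. c b * K e b) = (\<Sum>b\<in>A. c b * K b e)"
    by (rule sum.cong[OF refl]) (metis psd_kernel_sym[OF assms(1)])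
  finally show ?thesis
    by (simp add: distrib_left sum.distrib sum_distrib_left power2_eq_square mult_ac)
qed

lemma psd_kernel_zero_column:
  assumes "psd_kernel K" "K e e = 0"
  shows "K a e = 0"
proof (rule ccontr)
  assume ne: "K a e \<noteq> 0"
  define t where "t = - (K a a + 1) / (2 * K a e)"
  have "0 \<le> K a a + 2 * t * K a e"
    using psd_kernel_form_add_point[OF assms(1), of "{a}" "\<lambda>_. 1" t e] assms(2) by simp
  moreover have "2 * t * K a e = - (K a a + 1)"
    using ne by (simp add: t_def)
  ultimately show False by linarith
qed

definition schur_complement :: "('i \<Rightarrow> 'i \<Rightarrow> real) \<Rightarrow> 'i \<Rightarrow> 'i \<Rightarrow> 'i \<Rightarrow> real" where
  "schur_complement K e a b = K a b - K a e * K e b / K e e"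

text \<open>
  The quadratic form of the Schur complement is the minimum of the form of \<open>K\<close> over the
  coefficient at \<open>e\<close>. If \<open>K e e = 0\<close>, the whole column of \<open>e\<close> is zero, and division by zero
  rightly leaves \<open>K\<close> unchanged.
\<close>

lemma psd_kernel_schur_complement:
  assumes K: "psd_kernel K"
  shows "psd_kernel (schur_complement K e)"
  unfolding psd_kernel_def
proof (intro conjI allI impI)
  show "schur_complement K e a b = schur_complement K e b a" for a b
    using psd_kernel_sym[OF K] by (simp add: schur_complement_def mult.commute)
next
  fix A :: "'a set" and c :: "'a \<Rightarrow> real" assume A: "finite A"
  define B where "B = (\<Sum>a\<in>A. c a * K a e)"
  have "(\<Sum>a\<in>A. \<Sum>b\<in>A. c a * c b * (K a e * K e b / K e e)) = B * B / K e e"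
    unfolding B_def sum_product sum_divide_distrib
  proof (intro sum.cong refl)
    fix a b
    show "c a * c b * (K a e * K e b / K e e) = c a * K a e * (c b * K b e) / K e e"
      using psd_kernel_sym[OF K, of e b] by simp
  qed
  then have eq: "(\<Sum>a\<in>A. \<Sum>b\<in>A. c a * c b * schur_complement K e a b)
      = (\<Sum>a\<in>A. \<Sum>b\<in>A. c a * c b * K a b) - B * B / K e e"
    by (simp add: schur_complement_def right_diff_distrib sum_subtractf)
  show "0 \<le> (\<Sum>a\<in>A. \<Sum>b\<in>A. c a * c b * schur_complement K e a b)"
  proof (cases "K e e = 0")
    case True
    then show ?thesis using psd_kernel_form_nonneg[OF K A] eq by simp
  next
    case False
    have "0 \<le> (\<Sum>a\<in>A. \<Sum>b\<in>A. c a * c b * K a b) + 2 * (- B / K e e) * B + (- B / K e e)\<^sup>2 * K e e"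
      unfolding B_def by (rule psd_kernel_form_add_point[OF K A])
    moreover have "2 * (- B / K e e) * B + (- B / K e e)\<^sup>2 * K e e = - (B * B / K e e)"
      using False by (simp add: power2_eq_square field_simps)
    ultimately show ?thesis using eq by linarith
  qed
qed

text \<open>
  Gaussian elimination along the enumeration of the index type; the pivot columns, suitably
  scaled, form the Cholesky factor.
\<close>

primrec schur_iter :: "('i::countable \<Rightarrow> 'i \<Rightarrow> real) \<Rightarrow> nat \<Rightarrow> 'i \<Rightarrow> 'i \<Rightarrow> real" where
  "schur_iter K 0 = K"
| "schur_iter K (Suc n) = schur_complement (schur_iter K n) (from_nat n)"

lemma psd_kernel_schur_iter: "psd_kernel K \<Longrightarrow> psd_kernel (schur_iter K n)"
  by (induction n) (simp_all add: psd_kernel_schur_complement)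

lemma schur_iter_eliminated:
  assumes K: "psd_kernel K" and "j < n"
  shows "schur_iter K n a (from_nat j) = 0"
  using assms(2)
proof (induction n arbitrary: a)
  case (Suc n)
  let ?R = "schur_iter K n"
  have psd: "psd_kernel ?R" using K by (rule psd_kernel_schur_iter)
  show ?case
  proof (cases "j = n")
    case True
    then show ?thesis
      using psd_kernel_zero_column[OF psd, of "from_nat n" a]
      by (cases "?R (from_nat n) (from_nat n) = 0") (auto simp: schur_complement_def)
  next
    case False
    then have "?R a (from_nat j) = 0" for a using Suc by simp
    then show ?thesis by (simp add: schur_complement_def)
  qed
qed simp

definition cholesky :: "('i::countable \<Rightarrow> 'i \<Rightarrow> real) \<Rightarrow> nat \<Rightarrow> 'i \<Rightarrow> real" where
  "cholesky K n a = schur_iter K n a (from_nat n) / sqrt (schur_iter K n (from_nat n) (from_nat n))"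

lemma cholesky_triangular:
  assumes "psd_kernel K" "to_nat a < n"
  shows "cholesky K n a = 0"
  using schur_iter_eliminated[OF assms(1), of "to_nat a" n "from_nat n"] assms(2)
    psd_kernel_sym[OF psd_kernel_schur_iter[OF assms(1)]]
  by (metis cholesky_def div_0 from_nat_to_nat)

lemma cholesky_partial_sum:
  assumes K: "psd_kernel K"
  shows "K a b = (\<Sum>j<n. cholesky K j a * cholesky K j b) + schur_iter K n a b"
proof (induction n)
  case (Suc n)
  let ?R = "schur_iter K n" and ?e = "from_nat n"
  have psd: "psd_kernel ?R" using K by (rule psd_kernel_schur_iter)
  have "cholesky K n a * cholesky K n b = ?R a ?e * ?R ?e b / ?R ?e ?e"
    using psd_kernel_diag_nonneg[OF psd, of ?e] psd_kernel_sym[OF psd, of b]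
    by (simp add: cholesky_def)
  then show ?case using Suc by (simp add: schur_complement_def)
qed simp

lemma cholesky_factorization:
  assumes K: "psd_kernel K" and "to_nat b < n"
  shows "K a b = (\<Sum>j<n. cholesky K j a * cholesky K j b)"
  using cholesky_partial_sum[OF K, of a b n] schur_iter_eliminated[OF K assms(2), of a] by simp

lemma indep_vars_coordinates:
  assumes "\<And>i. prob_space (M i)"
  shows "prob_space.indep_vars (PiM UNIV M) M (\<lambda>i \<omega>. \<omega> i) UNIV"
proof -
  interpret prob_space "PiM UNIV M" by (intro prob_space_PiM assms)
  have "distr (PiM UNIV M) (PiM UNIV M) (\<lambda>\<omega>. \<lambda>i\<in>UNIV. \<omega> i) = PiM UNIV M"
    by (simp add: restrict_UNIV distr_id)
  also have "\<dots> = (\<Pi>\<^sub>M i\<in>UNIV. distr (PiM UNIV M) (M i) (\<lambda>\<omega>. \<omega> i))"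
    by (intro PiM_cong refl distr_PiM_component[symmetric] assms UNIV_I)
  finally show ?thesis
    by (subst indep_vars_iff_distr_eq_PiM) auto
qed

definition white_noise :: "(nat \<Rightarrow> real) measure" where
  "white_noise = (\<Pi>\<^sub>M k\<in>UNIV. density lborel std_normal_density)"

lemma prob_space_white_noise: "prob_space white_noise"
  unfolding white_noise_def
  by (intro prob_space_PiM prob_space_normal_density) simp

lemma white_noise_component:
  "distributed white_noise lborel (\<lambda>\<omega>. \<omega> n) std_normal_density"
proof -
  have "distr white_noise (density lborel std_normal_density) (\<lambda>\<omega>. \<omega> n) = density lborel std_normal_density"
    unfolding white_noise_def
    by (rule distr_PiM_component) (auto intro: prob_space_normal_density)
  moreover have "distr white_noise (density lborel std_normal_density) (\<lambda>\<omega>. \<omega> n) = distr white_noise lborel (\<lambda>\<omega>. \<omega> n)"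
    by (rule distr_cong) auto
  ultimately have "distr white_noise lborel (\<lambda>\<omega>. \<omega> n) = density lborel std_normal_density" by simp
  then show ?thesis
    by (auto simp: distributed_def white_noise_def)
qed

lemma white_noise_measurable [measurable]: "(\<lambda>\<omega>. \<omega> n) \<in> borel_measurable white_noise"
  using distributed_measurable[OF white_noise_component] by simp

lemma white_noise_indep: "prob_space.indep_vars white_noise (\<lambda>_. borel) (\<lambda>n \<omega>. \<omega> n) UNIV"
proof -
  interpret prob_space white_noise by (rule prob_space_white_noise)
  have "indep_vars (\<lambda>_. density lborel std_normal_density) (\<lambda>n \<omega>. \<omega> n) UNIV"
    unfolding white_noise_def
    by (rule indep_vars_coordinates) (auto intro: prob_space_normal_density)
  then show ?thesis
    by (auto simp: indep_vars_def2)
qed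

lemma white_noise_covariance:
  "integrable white_noise (\<lambda>\<omega>. \<omega> m * \<omega> n)"
  "(\<integral>\<omega>. \<omega> m * \<omega> n \<partial>white_noise) = of_bool (m = n)"
  "integrable white_noise (\<lambda>\<omega>. \<omega> n)"
  "(\<integral>\<omega>. \<omega> n \<partial>white_noise) = 0"
proof -
  interpret prob_space white_noise by (rule prob_space_white_noise)
  have mean: "expectation (\<lambda>\<omega>. \<omega> n) = 0" for n
    using standard_normal_distributed_expectation[OF white_noise_component] .
  have int: "integrable white_noise (\<lambda>\<omega>. \<omega> n)" for n
    using integrable_std_normal_moment[of 1]
    by (subst distributed_integrable[OF white_noise_component, symmetric]) auto
  have sq: "integrable white_noise (\<lambda>\<omega>. \<omega> n * \<omega> n)" for n
    using integrable_std_normal_moment[of 2]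
    by (subst distributed_integrable[OF white_noise_component, where g="\<lambda>x. x * x", symmetric])
       (auto simp: power2_eq_square)
  have var: "expectation (\<lambda>\<omega>. \<omega> n * \<omega> n) = 1" for n
    using standard_normal_distributed_variance[OF white_noise_component, of n] mean[of n]
    by (simp add: power2_eq_square)
  have ind: "indep_var borel (\<lambda>\<omega>. \<omega> m) borel (\<lambda>\<omega>. \<omega> n)" if "m \<noteq> n" for m n
    using indep_vars_sum[OF _ _ indep_vars_subset[OF white_noise_indep], of "{n}" m] that by simp
  show "integrable white_noise (\<lambda>\<omega>. \<omega> m * \<omega> n)"
    by (cases "m = n") (auto intro: sq indep_var_integrable[OF ind] int)
  show "(\<integral>\<omega>. \<omega> m * \<omega> n \<partial>white_noise) = of_bool (m = n)"
    using indep_var_lebesgue_integral[OF ind int int, of m n] mean var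
    by (cases "m = n") auto
  show "integrable white_noise (\<lambda>\<omega>. \<omega> n)" "(\<integral>\<omega>. \<omega> n \<partial>white_noise) = 0"
    by (fact int mean)+
qed

lemma gaussian_law_white_noise_combination:
  "gaussian_law (distr white_noise borel (\<lambda>\<omega>. \<Sum>n<m. d n * \<omega> n))"
proof -
  interpret prob_space white_noise by (rule prob_space_white_noise)
  define I where "I = {n. n < m \<and> d n \<noteq> 0}"
  have fin: "finite I" by (simp add: I_def)
  have eq: "(\<Sum>n<m. d n * \<omega> n) = (\<Sum>n\<in>I. d n * \<omega> n)" for \<omega> :: "nat \<Rightarrow> real"
    by (rule sum.mono_neutral_right) (auto simp: I_def)
  show ?thesis
  proof (cases "I = {}")
    case True
    have "distr white_noise borel (\<lambda>\<omega>. 0 :: real) = return borel 0"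
      by (rule distr_const) simp
    then show ?thesis
      unfolding gaussian_law_def eq True by auto
  next
    case False
    have "distributed white_noise lborel (\<lambda>\<omega>. 0 + d n * \<omega> n) (normal_density (0 + d n * 0) (\<bar>d n\<bar> * 1))"
      if "n \<in> I" for n
      using that by (intro normal_density_affine white_noise_component) (auto simp: I_def)
    then have D: "distributed white_noise lborel (\<lambda>\<omega>. d n * \<omega> n) (normal_density 0 \<bar>d n\<bar>)" if "n \<in> I" for n
      using that by simp
    have "indep_vars (\<lambda>_. borel) (\<lambda>n. (\<lambda>x. d n * x) \<circ> (\<lambda>\<omega>. \<omega> n)) I"
      by (rule indep_vars_compose[OF indep_vars_subset[OF white_noise_indep]]) auto
    then have "distributed white_noise lborel (\<lambda>\<omega>. \<Sum>n\<in>I. d n * \<omega> n)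
        (normal_density (\<Sum>n\<in>I. 0) (sqrt (\<Sum>n\<in>I. \<bar>d n\<bar>\<^sup>2)))"
      using fin False D by (intro sum_indep_normal) (auto simp: I_def comp_def)
    then have "distr white_noise lborel (\<lambda>\<omega>. \<Sum>n\<in>I. d n * \<omega> n) = density lborel (normal_density 0 (sqrt (\<Sum>n\<in>I. \<bar>d n\<bar>\<^sup>2)))"
      by (simp add: distributed_distr_eq_density)
    moreover have "distr white_noise lborel (\<lambda>\<omega>. \<Sum>n\<in>I. d n * \<omega> n) = distr white_noise borel (\<lambda>\<omega>. \<Sum>n\<in>I. d n * \<omega> n)"
      by (rule distr_cong) auto
    moreover have "0 < sqrt (\<Sum>n\<in>I. \<bar>d n\<bar>\<^sup>2)"
      using fin False by (auto intro!: sum_pos simp: I_def)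
    ultimately show ?thesis
      unfolding gaussian_law_def eq by metis
  qed
qed

text \<open>
  Kolmogorov extension is avoided: since the Cholesky factor is triangular along the enumeration
  of the index type, each coordinate of the field is a finite combination of independent
  standard normal variables.
\<close>

theorem centered_gaussian_field_exists:
  fixes K :: "'i::countable \<Rightarrow> 'i \<Rightarrow> real"
  assumes K: "psd_kernel K"
  obtains X where "centered_gaussian_field white_noise UNIV X K"
proof
  define X where "X a \<omega> = (\<Sum>j<Suc (to_nat a). cholesky K j a * \<omega> j)" for a and \<omega> :: "nat \<Rightarrow> real"
  have X_eq: "X a \<omega> = (\<Sum>j<m. cholesky K j a * \<omega> j)" if "to_nat a < m" for a m \<omega>
    unfolding X_def using that cholesky_triangular[OF K, of a]
    by (intro sum.mono_neutral_left) (auto simp: not_less_eq)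
  interpret prob_space white_noise by (rule prob_space_white_noise)
  show "centered_gaussian_field white_noise UNIV X K"
    unfolding centered_gaussian_field_def
  proof (intro conjI ballI allI impI)
    show "prob_space white_noise" by (rule prob_space_white_noise)
    show "X a \<in> borel_measurable white_noise" for a
      unfolding X_def by measurable
  next
    fix A :: "'i set" and c assume A: "finite A \<and> A \<subseteq> UNIV"
    obtain m where m: "\<And>a. a \<in> A \<Longrightarrow> to_nat a < m"
      using finite_nat_set_iff_bounded[of "to_nat ` A"] A by auto
    have "(\<Sum>a\<in>A. c a * X a \<omega>) = (\<Sum>a\<in>A. \<Sum>j<m. c a * cholesky K j a * \<omega> j)" for \<omega>
      by (intro sum.cong refl) (simp add: X_eq[OF m] sum_distrib_left mult.assoc)
    then have "(\<Sum>a\<in>A. c a * X a \<omega>) = (\<Sum>j<m. (\<Sum>a\<in>A. c a * cholesky K j a) * \<omega> j)" for \<omega>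
      by (simp add: sum_distrib_right sum.swap[of _ A])
    then show "gaussian_law (distr white_noise borel (\<lambda>\<omega>. \<Sum>a\<in>A. c a * X a \<omega>))"
      by (simp add: gaussian_law_white_noise_combination)
  next
    show "expectation (X a) = 0" for a
      unfolding X_def using white_noise_covariance by simp
  next
    fix a b :: 'i
    define m where "m = Suc (max (to_nat a) (to_nat b))"
    have Xm: "X a \<omega> = (\<Sum>j<m. cholesky K j a * \<omega> j)" "X b \<omega> = (\<Sum>j<m. cholesky K j b * \<omega> j)" for \<omega>
      by (rule X_eq; simp add: m_def)+
    have "expectation (\<lambda>\<omega>. X a \<omega> * X b \<omega>)
        = expectation (\<lambda>\<omega>. \<Sum>i<m. \<Sum>j<m. (cholesky K i a * cholesky K j b) * (\<omega> i * \<omega> j))"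
      by (simp add: Xm sum_product mult_ac)
    also have "\<dots> = (\<Sum>i<m. \<Sum>j<m. (cholesky K i a * cholesky K j b) * of_bool (i = j))"
      by (simp add: white_noise_covariance)
    also have "\<dots> = (\<Sum>i<m. cholesky K i a * cholesky K i b)"
      by (simp add: of_bool_def if_distrib cong: if_cong)
    also have "\<dots> = K a b"
      by (rule cholesky_factorization[OF K, symmetric]) (simp add: m_def)
    finally show "expectation (\<lambda>\<omega>. X a \<omega> * X b \<omega>) = K a b" .
  qed
qed

section \<open>Transition probabilities of the walks\<close>

lemma proj_0 [simp]: "proj 0 = (\<lambda>x. x)"
  by (simp add: proj_def fun_eq_iff vec_eq_iff)

lemma proj_nth [simp]: "proj N x $ i = x $ i mod int N"
  by (simp add: proj_def)

lemma proj_proj [simp]: "proj N (proj N x) = proj N x"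
  by (simp add: vec_eq_iff)

lemma proj_in_torus: "N \<ge> 1 \<Longrightarrow> proj N x \<in> torus N"
  by (simp add: torus_def)

lemma proj_torus: "x \<in> torus N \<Longrightarrow> proj N x = x"
  by (simp add: torus_def vec_eq_iff)

lemma proj_eq_iff: "proj N x = proj N y \<longleftrightarrow> (\<forall>i. int N dvd x $ i - y $ i)"
  unfolding vec_eq_iff proj_nth mod_eq_dvd_iff ..

lemma proj_eq_iff_diff: "proj N x = proj N y \<longleftrightarrow> proj N (x - y) = 0"
  unfolding proj_eq_iff by (simp add: vec_eq_iff mod_eq_0_iff_dvd)

lemma proj_eq_shift: "proj N x = proj N y \<Longrightarrow> proj N (x + s) = proj N (y + s)"
  by (simp add: proj_eq_iff)

lemma srw_torus_0: "srw_torus 0 = srw_lattice"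
proof (intro ext)
  show "srw_torus 0 x \<xi> k = srw_lattice x \<xi> k" for x :: "int ^ 'a" and \<xi> k
    by (induction k) auto
qed

lemma axis_neq_minus_axis: "axis i (1::int) \<noteq> - axis j 1"
proof
  assume "axis i (1::int) = - axis j 1"
  then have "axis i (1::int) $ i = (- axis j 1) $ i" by simp
  then show False by (auto simp: axis_def split: if_splits)
qed

lemma inj_axis_1: "inj (\<lambda>i. axis i (1::int))" "inj (\<lambda>i. - axis i (1::int))"
  by (auto simp: inj_def axis_eq_axis)

lemma finite_unit_steps [simp]: "finite (unit_steps :: (int ^ 'd) set)"
  by (simp add: unit_steps_def)

lemma unit_steps_nonempty [simp]: "(unit_steps :: (int ^ 'd) set) \<noteq> {}"
  by (simp add: unit_steps_def)

lemma sum_unit_steps: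
  fixes f :: "int ^ 'd \<Rightarrow> 'a::comm_monoid_add"
  shows "(\<Sum>s\<in>unit_steps. f s) = (\<Sum>i\<in>UNIV. f (axis i 1) + f (- axis i 1))"
proof -
  have "(\<Sum>s\<in>unit_steps. f s)
      = (\<Sum>s\<in>range (\<lambda>i. axis i 1). f s) + (\<Sum>s\<in>range (\<lambda>i. - axis i 1). f s)"
    unfolding unit_steps_def
    by (rule sum.union_disjoint) (auto simp: axis_neq_minus_axis)
  also have "\<dots> = (\<Sum>i\<in>UNIV. f (axis i 1)) + (\<Sum>i\<in>UNIV. f (- axis i 1))"
    by (simp add: sum.reindex inj_axis_1)
  finally show ?thesis by (simp add: sum.distrib)
qed

lemma card_unit_steps: "card (unit_steps :: (int ^ 'd) set) = 2 * CARD('d)"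
  using sum_unit_steps[of "\<lambda>_ :: int ^ 'd. 1 :: nat"] by simp

lemma unit_steps_bound: "s \<in> unit_steps \<Longrightarrow> \<bar>s $ i\<bar> \<le> 1"
  by (auto simp: unit_steps_def axis_def)

lemma unit_steps_minus: "(\<Sum>s\<in>unit_steps. f (- s)) = (\<Sum>s\<in>unit_steps. f s)"
  for f :: "int ^ 'd \<Rightarrow> 'a::comm_monoid_add"
  by (simp add: sum_unit_steps add.commute)

text \<open>
  The probability that the walk from \<open>z\<close> is in \<open>N \<int>\<^sup>d\<close> at time \<open>n\<close>. The torus walk from
  \<open>x\<close> is at \<open>y\<close> with probability \<open>ret N n (x - y)\<close>; the case \<open>N = 0\<close> is the walk on the lattice.
\<close>

primrec ret :: "nat \<Rightarrow> nat \<Rightarrow> int ^ 'd \<Rightarrow> real" where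
  "ret N 0 z = of_bool (proj N z = 0)"
| "ret N (Suc n) z = (\<Sum>s\<in>unit_steps. ret N n (z + s)) / (2 * CARD('d))"

lemma ret_nonneg [simp]: "0 \<le> ret N n z"
  by (induction n arbitrary: z) (auto intro!: divide_nonneg_nonneg sum_nonneg)

lemma ret_minus: "ret N n (- z) = ret N n z"
proof (induction n arbitrary: z)
  case 0
  have "proj N (- z) = 0 \<longleftrightarrow> proj N z = 0"
    by (simp add: vec_eq_iff mod_eq_0_iff_dvd)
  then show ?case by simp
next
  case (Suc n)
  have "(\<Sum>s\<in>unit_steps. ret N n (- z + s)) = (\<Sum>s\<in>unit_steps. ret N n (- (z + - s)))"
    by simp
  also have "\<dots> = (\<Sum>s\<in>unit_steps. ret N n (z + s))"
    unfolding Suc by (rule unit_steps_minus)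
  finally show ?case by simp
qed

lemma ret_commute: "ret N n (x - y) = ret N n (y - x)"
  using ret_minus[of N n "y - x"] by simp

lemma ret_cong_proj: "proj N z = proj N w \<Longrightarrow> ret N n z = ret N n w"
proof (induction n arbitrary: z w)
  case 0
  then show ?case by (simp add: vec_eq_iff)
next
  case (Suc n)
  have "ret N n (z + s) = ret N n (w + s)" for s
    by (rule Suc.IH) (rule proj_eq_shift[OF Suc.prems])
  then show ?case by simp
qed

subsection \<open>The law of the walk\<close>

interpretation step_sequence: sequence_space "measure_pmf (pmf_of_set unit_steps)"
  by unfold_locales

lemma space_increments [simp]: "space increments = UNIV"
  by (simp add: increments_def space_PiM)

lemma prob_space_increments: "prob_space increments"
  unfolding increments_def by (intro prob_space_PiM measure_pmf.prob_space_axioms)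

lemma measurable_component_increments [measurable]:
  "(\<lambda>\<xi>. \<xi> k) \<in> increments \<rightarrow>\<^sub>M count_space UNIV"
  unfolding increments_def
  by (rule measurable_compose[OF measurable_component_singleton]) auto

lemma measurable_srw_torus [measurable]:
  "(\<lambda>\<xi>. srw_torus N x \<xi> k) \<in> increments \<rightarrow>\<^sub>M count_space UNIV"
proof (induction k)
  case (Suc k)
  note [measurable] = Suc
  show ?case unfolding srw_torus.simps by measurable
qed simp

lemma srw_torus_first_step:
  "srw_torus N x (case_nat s \<xi>) (Suc n) = srw_torus N (proj N (x + s)) \<xi> n"
  by (induction n) auto

text \<open>
  The sequence of increments is a first increment followed by an independent copy of the sequence.
\<close>

lemma increments_first_step:
  fixes A :: "(nat \<Rightarrow> int ^ 'd) set"
  assumes A: "A \<in> sets increments"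
  shows "measure increments A
    = (\<Sum>s\<in>unit_steps. measure increments {\<xi>. case_nat s \<xi> \<in> A}) / (2 * CARD('d))"
proof -
  interpret I: prob_space increments by (rule prob_space_increments)
  let ?M = "measure_pmf (pmf_of_set (unit_steps :: (int ^ 'd) set))"
  have m: "(\<lambda>(s, \<xi>). case_nat s \<xi>) \<in> ?M \<Otimes>\<^sub>M increments \<rightarrow>\<^sub>M increments"
    unfolding increments_def by measurable
  have "emeasure increments A = emeasure (distr (?M \<Otimes>\<^sub>M increments) increments (\<lambda>(s, \<xi>). case_nat s \<xi>)) A"
    unfolding increments_def by (simp only: step_sequence.PiM_iter)
  also have "\<dots> = emeasure (?M \<Otimes>\<^sub>M increments) ((\<lambda>(s, \<xi>). case_nat s \<xi>) -` A \<inter> space (?M \<Otimes>\<^sub>M increments))"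
    by (rule emeasure_distr[OF m A])
  also have "\<dots> = (\<integral>\<^sup>+ s. emeasure increments (Pair s -` ((\<lambda>(s, \<xi>). case_nat s \<xi>) -` A \<inter> space (?M \<Otimes>\<^sub>M increments))) \<partial>?M)"
    by (rule I.emeasure_pair_measure_alt) (rule measurable_sets[OF m A])
  also have "\<dots> = (\<integral>\<^sup>+ s. ennreal (measure increments {\<xi>. case_nat s \<xi> \<in> A}) \<partial>?M)"
    by (intro nn_integral_cong)
       (auto simp: I.emeasure_eq_measure space_pair_measure intro!: arg_cong[where f="measure increments"])
  also have "\<dots> = (\<Sum>s\<in>unit_steps. ennreal (measure increments {\<xi>. case_nat s \<xi> \<in> A})) / ennreal (2 * CARD('d))"
    by (subst nn_integral_pmf_of_set) (simp_all add: card_unit_steps ennreal_of_nat_eq_real_of_nat)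
  also have "\<dots> = ennreal ((\<Sum>s\<in>unit_steps. measure increments {\<xi>. case_nat s \<xi> \<in> A}) / (2 * CARD('d)))"
    by (simp add: sum_ennreal divide_ennreal sum_nonneg)
  finally show ?thesis
    by (simp add: I.emeasure_eq_measure sum_nonneg)
qed

lemma prob_srw_torus_proj:
  assumes "proj N x = x" "proj N y = y"
  shows "measure increments {\<xi>. srw_torus N x \<xi> n = y} = ret N n (x - y)"
  using assms
proof (induction n arbitrary: x)
  case 0
  have "x = y \<longleftrightarrow> proj N (x - y) = 0"
    using 0 proj_eq_iff_diff[of N x y] by simp
  then show ?case
    using prob_space.prob_space[OF prob_space_increments] by auto
next
  case (Suc n)
  have "measure increments {\<xi>. case_nat s \<xi> \<in> {\<xi>. srw_torus N x \<xi> (Suc n) = y}} = ret N n (x - y + s)" for s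
  proof -
    have "measure increments {\<xi>. case_nat s \<xi> \<in> {\<xi>. srw_torus N x \<xi> (Suc n) = y}} = ret N n (proj N (x + s) - y)"
      unfolding mem_Collect_eq srw_torus_first_step using Suc by simp
    also have "\<dots> = ret N n (x - y + s)"
      by (rule ret_cong_proj) (simp add: proj_eq_iff algebra_simps dvd_diff_commute mod_eq_dvd_iff[symmetric])
    finally show ?thesis .
  qed
  moreover have "{\<xi>. srw_torus N x \<xi> (Suc n) = y} \<in> sets increments"
    using measurable_sets[OF measurable_srw_torus, of "{y}" N x "Suc n"] by (simp add: vimage_def)
  ultimately show ?case
    by (subst increments_first_step) simp_all
qed

lemma prob_srw_torus:
  assumes "x \<in> torus N" "y \<in> torus N"
  shows "measure increments {\<xi>. srw_torus N x \<xi> n = y} = ret N n (x - y)"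
  using assms by (intro prob_srw_torus_proj proj_torus)

lemma prob_srw_lattice:
  "measure increments {\<xi>. srw_lattice x \<xi> n = y} = ret 0 n (x - y)"
  using prob_srw_torus_proj[of 0 x y n] by (simp add: srw_torus_0)

section \<open>Fourier series on the torus\<close>

lemma torus_eq_box: "torus N = {m :: int ^ 'd. \<forall>i. m $ i \<in> {0..<int N}}"
  by (auto simp: torus_def)

text \<open>
  Sums over the torus of functions that factorize over the coordinates reduce to one dimension.
\<close>

lemma sum_box_prod:
  fixes f :: "'d::finite \<Rightarrow> int \<Rightarrow> 'b::comm_semiring_1"
  assumes "finite A"
  shows "(\<Sum>m\<in>{m :: int ^ 'd. \<forall>i. m $ i \<in> A}. \<Prod>i\<in>UNIV. f i (m $ i)) = (\<Prod>i\<in>UNIV. \<Sum>j\<in>A. f i j)"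
proof -
  have "(\<Prod>i\<in>UNIV. \<Sum>j\<in>A. f i j) = (\<Sum>g\<in>PiE UNIV (\<lambda>_. A). \<Prod>i\<in>UNIV. f i (g i))"
    by (rule prod_sum_PiE) (simp_all add: assms)
  also have "\<dots> = (\<Sum>m\<in>{m :: int ^ 'd. \<forall>i. m $ i \<in> A}. \<Prod>i\<in>UNIV. f i (m $ i))"
    by (rule sum.reindex_bij_witness[where i="\<lambda>m. ($) m" and j="\<lambda>g. vec_lambda g"])
       (auto simp: PiE_iff)
  finally show ?thesis ..
qed

lemma card_box:
  assumes "finite A"
  shows "card {m :: int ^ 'd. \<forall>i. m $ i \<in> A} = card A ^ CARD('d)"
  using sum_box_prod[OF assms, of "\<lambda>(_ :: 'd) _. 1 :: nat"] by simp

lemma card_torus: "card (torus N :: (int ^ 'd) set) = N ^ CARD('d)"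
  unfolding torus_eq_box by (subst card_box) auto

lemma finite_box: "finite A \<Longrightarrow> finite {m :: int ^ 'd. \<forall>i. m $ i \<in> A}"
  by (rule finite_subset[OF _ finite_imageI[OF finite_PiE[of "UNIV :: 'd set" "\<lambda>_. A"], of vec_lambda]])
     (auto simp: image_iff PiE_iff intro!: bexI[where x="($) _"])

lemma finite_torus [simp]: "finite (torus N)"
  unfolding torus_eq_box by (intro finite_box) simp

lemma zero_in_torus: "N \<ge> 1 \<Longrightarrow> 0 \<in> torus N"
  by (simp add: torus_def)

definition phase :: "nat \<Rightarrow> int ^ 'd \<Rightarrow> int ^ 'd \<Rightarrow> real" where
  "phase N m z = (\<Sum>i\<in>UNIV. 2 * pi * m $ i * z $ i / N)"

definition eig :: "nat \<Rightarrow> int ^ 'd \<Rightarrow> real" where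
  "eig N m = (\<Sum>i\<in>UNIV. cos (2 * pi * m $ i / N)) / CARD('d)"

lemma abs_eig_le_1: "\<bar>eig N m\<bar> \<le> 1" for m :: "int ^ 'd"
proof -
  have "\<bar>\<Sum>i\<in>UNIV. cos (2 * pi * m $ i / N)\<bar> \<le> (\<Sum>i\<in>(UNIV :: 'd set). 1)"
    by (rule order_trans[OF sum_abs]) (intro sum_mono abs_cos_le_one)
  then show ?thesis
    by (simp add: eig_def divide_le_eq)
qed

lemma eig_0 [simp]: "eig N 0 = 1"
  by (simp add: eig_def)

lemma phase_0 [simp]: "phase N 0 z = 0"
  by (simp add: phase_def)

lemma geometric_sum_roots_of_unity:
  assumes "N \<ge> 1"
  shows "(\<Sum>j\<in>{0..<int N}. cis (2 * pi * j * z / N)) = (if int N dvd z then of_nat N else 0)"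
proof -
  define w where "w = cis (2 * pi * z / N)"
  have w_power: "w ^ n = cis (2 * pi * int n * z / N)" for n
    unfolding w_def Complex.DeMoivre by (rule arg_cong[where f=cis]) simp
  have "(\<Sum>j\<in>{0..<int N}. cis (2 * pi * j * z / N)) = (\<Sum>j<N. w ^ j)"
    by (rule sum.reindex_bij_witness[where i=int and j=nat]) (auto simp: w_power)
  also have "\<dots> = (if w = 1 then of_nat N else (1 - w ^ N) / (1 - w))"
    by (rule sum_gp_strict)
  also have "w ^ N = 1"
    using assms cis_multiple_2pi[of "real_of_int z"] by (simp add: w_power mult.assoc)
  also have "w = 1 \<longleftrightarrow> int N dvd z"
  proof
    assume "w = 1"
    then have "cos (2 * pi * z / N) = 1"
      by (metis w_def cis.simps(1) one_complex.simps(1))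
    then obtain n :: int where "2 * pi * z / N = n * 2 * pi"
      unfolding cos_one_2pi_int by auto
    then have "real_of_int z = real_of_int (int N * n)"
      using assms by (simp add: field_simps)
    then show "int N dvd z"
      by (metis dvd_triv_left of_int_eq_iff)
  next
    assume "int N dvd z"
    then obtain n where "z = int N * n" by auto
    then have "2 * pi * z / N = 2 * pi * of_int n" using assms by simp
    then show "w = 1" by (simp only: w_def cis_multiple_2pi Ints_of_int)
  qed
  finally show ?thesis by simp
qed

lemma fourier_orthogonality:
  fixes z :: "int ^ 'd"
  assumes "N \<ge> 1"
  shows "(\<Sum>m\<in>torus N. cos (phase N m z)) = real N ^ CARD('d) * of_bool (proj N z = 0)"
proof -
  have "(\<Sum>m\<in>torus N. cis (phase N m z)) = (\<Sum>m\<in>torus N. \<Prod>i\<in>UNIV. cis (2 * pi * m $ i * z $ i / N))"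
    by (simp add: phase_def cis_conv_exp sum_distrib_left exp_sum)
  also have "\<dots> = (\<Prod>i\<in>UNIV. \<Sum>j\<in>{0..<int N}. cis (2 * pi * j * z $ i / N))"
    unfolding torus_eq_box by (rule sum_box_prod) simp
  also have "\<dots> = (\<Prod>i\<in>UNIV. (if int N dvd z $ i then of_nat N else 0))"
    using assms by (simp add: geometric_sum_roots_of_unity)
  also have "\<dots> = of_real (real N ^ CARD('d) * of_bool (proj N z = 0))"
    by (auto simp: vec_eq_iff mod_eq_0_iff_dvd prod_zero_iff)
  finally have "Re (\<Sum>m\<in>torus N. cis (phase N m z)) = real N ^ CARD('d) * of_bool (proj N z = 0)"
    by simp
  then show ?thesis by simp
qed

lemma phase_add: "phase N m (z + w) = phase N m z + phase N m w"
  by (simp add: phase_def sum.distrib[symmetric] distrib_left add_divide_distrib)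

lemma phase_minus: "phase N m (- w) = - phase N m w"
  by (simp add: phase_def sum_negf)

lemma phase_axis: "phase N m (axis i 1) = 2 * pi * m $ i / N"
  by (simp add: phase_def axis_def if_distrib[of real_of_int] if_distrib[of "\<lambda>x. _ * x"] if_distrib[of "\<lambda>x. x / _"] cong: if_cong)

text \<open>
  The functions \<open>\<lambda>z. cos (phase N m z)\<close> are eigenfunctions of the averaging over unit steps, with
  eigenvalue \<open>eig N m\<close>, and at time \<open>0\<close> the formula is orthogonality of characters.
\<close>

lemma ret_fourier:
  fixes z :: "int ^ 'd"
  assumes "N \<ge> 1"
  shows "ret N n z = (\<Sum>m\<in>torus N. eig N m ^ n * cos (phase N m z)) / real N ^ CARD('d)"
proof (induction n arbitrary: z)
  case 0
  then show ?case using fourier_orthogonality[OF assms, of z] assms by simp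
next
  case (Suc n)
  have step: "(\<Sum>s\<in>unit_steps. cos (phase N m (z + s))) = 2 * CARD('d) * eig N m * cos (phase N m z)" for m :: "int ^ 'd"
  proof -
    have "(\<Sum>s\<in>unit_steps. cos (phase N m (z + s))) = (\<Sum>i\<in>UNIV. 2 * cos (phase N m z) * cos (2 * pi * m $ i / N))"
      by (simp add: sum_unit_steps phase_add phase_minus phase_axis cos_add mult.assoc)
    then show ?thesis
      by (simp add: eig_def flip: sum_distrib_left)
  qed
  have "ret N (Suc n) z
      = (\<Sum>s\<in>unit_steps. \<Sum>m\<in>torus N. eig N m ^ n * cos (phase N m (z + s))) / real N ^ CARD('d) / (2 * CARD('d))"
    by (simp add: Suc sum_divide_distrib)
  also have "(\<Sum>s\<in>unit_steps. \<Sum>m\<in>torus N. eig N m ^ n * cos (phase N m (z + s)))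
      = (\<Sum>m\<in>torus N. eig N m ^ n * (2 * CARD('d) * eig N m * cos (phase N m z)))"
    by (subst sum.swap) (simp add: sum_distrib_left[symmetric] step)
  finally show ?case
    by (simp add: sum_divide_distrib mult.left_commute mult.assoc)
qed

text \<open>
  The kernel of \<open>(P ^ k + P ^ (k + 1))\<^sup>2\<close>, with \<open>P\<close> the transition operator of the walk.
\<close>

definition slice :: "nat \<Rightarrow> nat \<Rightarrow> int ^ 'd \<Rightarrow> real" where
  "slice N k z = ret N (2 * k) z + 2 * ret N (2 * k + 1) z + ret N (2 * k + 2) z"

lemma slice_fourier:
  fixes z :: "int ^ 'd"
  assumes "N \<ge> 1"
  shows "slice N k z = (\<Sum>m\<in>torus N. (eig N m ^ k * (1 + eig N m))\<^sup>2 * cos (phase N m z)) / real N ^ CARD('d)"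
proof -
  have "(e ^ k * (1 + e))\<^sup>2 = e ^ (2 * k) + 2 * e ^ (2 * k + 1) + e ^ (2 * k + 2)" for e :: real
  proof -
    have "(e ^ k * (1 + e))\<^sup>2 = e ^ (2 * k) * (1 + e)\<^sup>2"
      by (simp add: power_mult_distrib power_mult[symmetric] mult.commute)
    then show ?thesis by (simp add: power2_eq_square algebra_simps)
  qed
  note square = this
  have "slice N k z = (\<Sum>m\<in>torus N. (eig N m ^ (2 * k) + 2 * eig N m ^ (2 * k + 1) + eig N m ^ (2 * k + 2))
      * cos (phase N m z)) / real N ^ CARD('d)"
    unfolding slice_def ret_fourier[OF assms]
    by (simp only: sum.distrib distrib_right sum_distrib_left add_divide_distrib times_divide_eq_right mult.assoc)
  then show ?thesis by (simp only: square)
qed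

lemma slice_fourier_centred:
  fixes z :: "int ^ 'd"
  assumes "N \<ge> 1"
  shows "slice N k z - 4 / real N ^ CARD('d)
    = (\<Sum>m\<in>torus N - {0}. (eig N m ^ k * (1 + eig N m))\<^sup>2 * cos (phase N m z)) / real N ^ CARD('d)"
  using assms
  by (simp add: slice_fourier sum.remove[OF finite_torus zero_in_torus] add_divide_distrib)

subsection \<open>Heat kernel bound\<close>

lemma sin_pi_lower:
  assumes "0 \<le> x" "x \<le> 1 / 2"
  shows "2 * x \<le> sin (pi * x)"
proof -
  have "convex_on {0..pi} (\<lambda>x. - sin x)"
    by (rule f''_ge0_imp_convex[where f'="\<lambda>x. - cos x" and f''=sin])
       (auto intro!: derivative_eq_intros sin_ge_zero)
  from convex_onD[OF this, of "2 * x" 0 "pi / 2"] show ?thesis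
    using assms by (simp add: algebra_simps)
qed

lemma one_minus_cos_lower:
  assumes "0 \<le> x" "x \<le> 1"
  shows "8 * (min x (1 - x))\<^sup>2 \<le> 1 - cos (2 * pi * x)"
proof -
  define y where "y = min x (1 - x)"
  have y: "0 \<le> y" "y \<le> 1 / 2" using assms by (auto simp: y_def min_def)
  have "sin (pi * y) = sin (pi * x)"
    using sin_pi_minus[of "pi * x"] by (simp add: y_def min_def algebra_simps)
  then have "2 * y \<le> sin (pi * x)" using sin_pi_lower[OF y] by simp
  then have "(2 * y)\<^sup>2 \<le> (sin (pi * x))\<^sup>2" using y by (intro power_mono) auto
  moreover have "cos (2 * pi * x) = 1 - 2 * (sin (pi * x))\<^sup>2"
    using cos_double_sin[of "pi * x"] by (simp add: mult.assoc)
  ultimately show ?thesis by (simp add: y_def power_mult_distrib)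
qed

text \<open>
  With \<open>x = (n + 1) powr (1/6)\<close> and \<open>y = n powr (1/6)\<close>, the induction step is the factorization of
  \<open>x ^ 6 - y ^ 6 = 1\<close>.
\<close>

lemma sum_powr_5_6_le: "(\<Sum>j=1..n. real j powr (- (5/6))) \<le> 6 * real n powr (1/6)"
proof (induction n)
  case (Suc n)
  define x y where "x = real (Suc n) powr (1/6)" and "y = real n powr (1/6)"
  have xy: "0 \<le> y" "y \<le> x" "0 < x" by (auto simp: x_def y_def intro!: powr_mono2)
  have pw: "(r powr (1/6)) ^ 6 = r" if "0 \<le> r" for r :: real
    using that by (cases "r = 0") (auto simp: powr_power)
  have x6: "x ^ 6 = real (Suc n)" and y6: "y ^ 6 = real n"
    unfolding x_def y_def by (auto intro!: pw)
  have p5: "real (Suc n) powr (- (5/6)) = 1 / x ^ 5"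
    unfolding x_def by (subst powr_power) (auto simp: powr_minus field_simps)
  have "1 = x ^ 6 - y ^ 6" by (simp add: x6 y6)
  also have "\<dots> = (x - y) * (x ^ 5 + x ^ 4 * y + x ^ 3 * y ^ 2 + x ^ 2 * y ^ 3 + x * y ^ 4 + y ^ 5)"
    by (simp add: algebra_simps eval_nat_numeral)
  also have "\<dots> \<le> (x - y) * (6 * x ^ 5)"
  proof (rule mult_left_mono)
    have "x ^ a * y ^ b \<le> x ^ (a + b)" for a b
      using xy unfolding power_add by (intro mult_left_mono power_mono) auto
    from this[of 4 1] this[of 3 2] this[of 2 3] this[of 1 4] this[of 0 5]
    show "x ^ 5 + x ^ 4 * y + x ^ 3 * y ^ 2 + x ^ 2 * y ^ 3 + x * y ^ 4 + y ^ 5 \<le> 6 * x ^ 5"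
      by simp
  qed (use xy in auto)
  finally have "1 / x ^ 5 \<le> 6 * (x - y)"
    using xy by (simp add: field_simps)
  moreover have "(\<Sum>j=1..Suc n. real j powr (- (5/6))) = (\<Sum>j=1..n. real j powr (- (5/6))) + 1 / x ^ 5"
    using p5 by simp
  moreover have "(\<Sum>j=1..n. real j powr (- (5/6))) \<le> 6 * y"
    using Suc by (simp add: y_def)
  ultimately have "(\<Sum>j=1..Suc n. real j powr (- (5/6))) \<le> 6 * y + 6 * (x - y)"
    by (metis add_mono)
  then show ?case by (simp add: x_def)
qed simp

text \<open>
  For \<open>0 \<le> j < N\<close> the distance to \<open>N \<int>\<close>, except that multiples of \<open>N\<close> get the value \<open>1\<close>: the zero
  coordinates of a nonzero frequency must not make products over the coordinates vanish.
\<close>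

definition dist_multiple :: "nat \<Rightarrow> int \<Rightarrow> real" where
  "dist_multiple N j = max 1 (min (real_of_int j) (real N - j))"

text \<open>
  A Riemann sum of \<open>\<bar>x\<bar> powr (- \<beta>)\<close> on \<open>[-1/2, 1/2]\<close>, with the value at \<open>0\<close> cut off, bounded uniformly in \<open>N\<close> as long as \<open>\<beta>\<close> stays
  away from \<open>1\<close>. The value \<open>\<beta> = 5 / (2 * d)\<close> used below is at most \<open>5/6\<close> for \<open>d \<ge> 3\<close>.
\<close>

lemma sum_dist_multiple:
  assumes N: "N \<ge> 1" and \<beta>: "0 \<le> \<beta>" "\<beta> \<le> 5/6"
  shows "(\<Sum>j\<in>{0..<int N}. (N / dist_multiple N j) powr \<beta>) / N \<le> 13"
proof -
  let ?a = "- (5/6) :: real"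
  have le: "(N / dist_multiple N j) powr \<beta> \<le> real N powr (5/6) * dist_multiple N j powr ?a"
    if "j \<in> {0..<int N}" for j
  proof -
    have "1 \<le> dist_multiple N j" "dist_multiple N j \<le> N"
      using that N by (auto simp: dist_multiple_def)
    then have "(N / dist_multiple N j) powr \<beta> \<le> (N / dist_multiple N j) powr (5/6)"
      using \<beta> by (intro powr_mono) auto
    also have "\<dots> = real N powr (5/6) * dist_multiple N j powr ?a"
      using \<open>1 \<le> dist_multiple N j\<close> by (simp add: powr_divide powr_minus_divide)
    finally show ?thesis .
  qed
  have dp: "dist_multiple N (int j) powr ?a \<le> real j powr ?a + real (N - j) powr ?a" if "j \<in> {1..<N}" for j
    using that by (auto simp: dist_multiple_def min_def max_def of_nat_diff)
  have "(\<Sum>j\<in>{0..<int N}. dist_multiple N j powr ?a) = (\<Sum>j\<in>{0..<N}. dist_multiple N (int j) powr ?a)"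
    by (rule sum.reindex_bij_witness[where i=int and j=nat]) auto
  also have "\<dots> = dist_multiple N 0 powr ?a + (\<Sum>j\<in>{1..<N}. dist_multiple N (int j) powr ?a)"
    using N by (simp add: sum.atLeast_Suc_lessThan)
  also have "\<dots> \<le> 1 + (\<Sum>j\<in>{1..<N}. real j powr ?a + real (N - j) powr ?a)"
    using N by (intro add_mono sum_mono dp) (auto simp: dist_multiple_def)
  also have "(\<Sum>j\<in>{1..<N}. real j powr ?a + real (N - j) powr ?a) = 2 * (\<Sum>j\<in>{1..<N}. real j powr ?a)"
  proof -
    have "(\<Sum>j\<in>{1..<N}. real (N - j) powr ?a) = (\<Sum>j\<in>{1..<N}. real j powr ?a)"
      by (rule sum.reindex_bij_witness[where i="\<lambda>j. N - j" and j="\<lambda>j. N - j"]) auto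
    then show ?thesis by (simp add: sum.distrib)
  qed
  also have "(\<Sum>j\<in>{1..<N}. real j powr ?a) \<le> (\<Sum>j=1..N. real j powr ?a)"
    by (rule sum_mono2) auto
  also have "\<dots> \<le> 6 * real N powr (1/6)" by (rule sum_powr_5_6_le)
  finally have "(\<Sum>j\<in>{0..<int N}. dist_multiple N j powr ?a) \<le> 1 + 12 * real N powr (1/6)" by simp
  also have "\<dots> \<le> 13 * real N powr (1/6)"
    using N by (simp add: ge_one_powr_ge_zero)
  finally have *: "(\<Sum>j\<in>{0..<int N}. dist_multiple N j powr ?a) \<le> 13 * real N powr (1/6)" .
  have "(\<Sum>j\<in>{0..<int N}. (N / dist_multiple N j) powr \<beta>)
      \<le> real N powr (5/6) * (\<Sum>j\<in>{0..<int N}. dist_multiple N j powr ?a)"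
    unfolding sum_distrib_left by (intro sum_mono le)
  also have "\<dots> \<le> real N powr (5/6) * (13 * real N powr (1/6))"
    by (intro mult_left_mono *) simp
  also have "\<dots> = 13 * N"
    using N by (simp add: powr_add[symmetric])
  finally show ?thesis using N by (simp add: divide_le_eq)
qed

lemma exp_neg_le_powr: "0 < s \<Longrightarrow> exp (- s) \<le> 2 * s powr (- (5/4))" for s :: real
proof -
  assume s: "0 < s"
  have "s powr (5/4) \<le> 1 + s\<^sup>2"
  proof (cases "s \<le> 1")
    case True
    then have "s powr (5/4) \<le> 1" using s by (intro powr_le1) auto
    then show ?thesis by (simp add: add_increasing2)
  next
    case False
    then have "s powr (5/4) \<le> s powr 2" by (intro powr_mono) auto
    then show ?thesis using s by (simp add: powr_numeral)
  qed
  also have "\<dots> \<le> 2 * exp s"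
    using exp_lower_Taylor_quadratic[of s] s by simp
  finally show ?thesis
    using s by (simp add: exp_minus powr_minus field_simps)
qed

text \<open>
  Near \<open>\<lambda> = 1\<close> the multiplier decays exponentially in \<open>k (1 - \<lambda>)\<close>; near \<open>\<lambda> = -1\<close>, where the
  powers of \<open>\<lambda>\<close> do not decay, the factor \<open>1 + \<lambda>\<close> helps.
\<close>

lemma multiplier_bound:
  assumes "-1 \<le> l" "l \<le> (1::real)" "k \<ge> 1"
  shows "(l ^ k * (1 + l))\<^sup>2 \<le> 4 * exp (- (2 * k * (1 - l))) + 1 / k\<^sup>2"
proof (cases "0 \<le> l")
  case True
  have "l ^ (2 * k) \<le> exp (- (1 - l)) ^ (2 * k)"
    using True exp_ge_add_one_self[of "- (1 - l)"] by (intro power_mono) auto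
  also have "\<dots> = exp (- (2 * k * (1 - l)))"
    by (simp add: exp_of_nat_mult[symmetric] algebra_simps)
  finally have "l ^ (2 * k) * (1 + l)\<^sup>2 \<le> exp (- (2 * k * (1 - l))) * 2\<^sup>2"
    using assms True by (intro mult_mono power_mono) auto
  then show ?thesis
    by (simp add: power_mult_distrib power_mult[symmetric] mult.commute[of k] add_increasing2)
next
  case False
  define s where "s = 1 + l"
  have s: "0 \<le> s" "s \<le> 1" using assms False by (auto simp: s_def)
  have "(- l) ^ k \<le> exp (- s) ^ k"
    using False exp_ge_add_one_self[of "- s"] by (intro power_mono) (auto simp: s_def)
  also have "\<dots> = exp (- (k * s))"
    by (simp add: exp_of_nat_mult[symmetric])
  finally have "(- l) ^ k \<le> exp (- (k * s))" .
  moreover have "k * s \<le> exp (k * s)"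
    using exp_ge_add_one_self[of "k * s"] by linarith
  ultimately have "(- l) ^ k * (k * s) \<le> exp (- (k * s)) * exp (k * s)"
    using s by (intro mult_mono) auto
  then have "(- l) ^ k * s \<le> 1 / k"
    using assms by (simp add: exp_minus field_simps)
  then have "((- l) ^ k * s)\<^sup>2 \<le> (1 / k)\<^sup>2"
    using s False by (intro power_mono) auto
  moreover have "((- l) ^ k * s)\<^sup>2 = (l ^ k * (1 + l))\<^sup>2"
    by (simp add: power_mult_distrib s_def flip: power_mult power_mult_distrib)
       (simp add: power_mult_distrib power_minus_even flip: power_mult)
  ultimately show ?thesis
    by (simp add: power_divide add_increasing)
qed

text \<open>
  For a frequency \<open>m \<noteq> 0\<close> the gap \<open>1 - eig N m\<close> is at least \<open>8 / d\<close> times the sum of the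
  \<open>(w i / N)\<^sup>2\<close>, where \<open>w i\<close> is the distance of \<open>m $ i\<close> to \<open>N \<int>\<close>. This sum is at least each
  \<open>(max 1 (w i) / N)\<^sup>2\<close>, hence at least their geometric mean, which makes the bound factorize.
\<close>

lemma spectral_gap_lower:
  fixes m :: "int ^ 'd"
  assumes m: "m \<in> torus N" "m \<noteq> 0"
  shows "8 / CARD('d) * (\<Prod>i\<in>UNIV. (dist_multiple N (m $ i) / N) powr (2 / CARD('d))) \<le> 1 - eig N m"
    "eig N m < 1"
proof -
  define w where "w i = min (real_of_int (m $ i)) (real N - m $ i)" for i
  define W where "W = (\<Sum>i\<in>UNIV. (w i / N)\<^sup>2)"
  have mi: "0 \<le> m $ i" "m $ i < int N" for i using m by (auto simp: torus_def)
  have N: "N \<ge> 1" using mi[of undefined] by auto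
  have w0: "0 \<le> w i" for i using mi[of i] by (simp add: w_def)
  have W1: "(w i / N)\<^sup>2 \<le> W" for i
    unfolding W_def by (rule member_le_sum) auto
  obtain i where "m $ i \<noteq> 0" using m by (auto simp: vec_eq_iff)
  then have "1 \<le> w i" using mi[of i] by (auto simp: w_def)
  then have "(1 / N)\<^sup>2 \<le> (w i / N)\<^sup>2" by (intro power_mono divide_right_mono) auto
  also have "\<dots> \<le> W" by (rule W1)
  finally have W2: "(1 / N)\<^sup>2 \<le> W" .
  have Wpos: "0 < W" using N by (intro less_le_trans[OF _ W2]) simp
  have dW: "(dist_multiple N (m $ i) / N)\<^sup>2 \<le> W" for i
    using W1[of i] W2 by (auto simp: dist_multiple_def w_def max_def)
  have dpos: "0 < dist_multiple N (m $ i) / N" for i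
    using N by (simp add: dist_multiple_def)
  have sq: "y powr (2 / c) = y\<^sup>2 powr (1 / c)" if "0 < y" for y c :: real
    using that powr_powr[of y 2 "1 / c"] by (simp add: powr_numeral)
  have "(\<Prod>i\<in>UNIV. (dist_multiple N (m $ i) / N) powr (2 / CARD('d)))
      = (\<Prod>i\<in>UNIV. ((dist_multiple N (m $ i) / N)\<^sup>2) powr (1 / CARD('d)))"
    by (intro prod.cong refl sq dpos)
  also have "\<dots> \<le> (\<Prod>i\<in>(UNIV :: 'd set). W powr (1 / CARD('d)))"
    using dW by (intro prod_mono conjI powr_mono2) auto
  also have "\<dots> = W"
    using Wpos by (simp add: powr_power)
  finally have P: "(\<Prod>i\<in>UNIV. (dist_multiple N (m $ i) / N) powr (2 / CARD('d))) \<le> W" .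
  have "8 * (w i / N)\<^sup>2 \<le> 1 - cos (2 * pi * m $ i / N)" for i
  proof -
    have "8 * (min (m $ i / N) (1 - m $ i / N))\<^sup>2 \<le> 1 - cos (2 * pi * (m $ i / N))"
      using mi[of i] by (intro one_minus_cos_lower) (auto simp: divide_le_eq)
    moreover have "min (m $ i / N) (1 - m $ i / N) = w i / N"
      using N by (auto simp: w_def min_def field_simps)
    ultimately show ?thesis by simp
  qed
  then have "8 * W \<le> (\<Sum>i\<in>UNIV. 1 - cos (2 * pi * m $ i / N))"
    unfolding W_def sum_distrib_left by (intro sum_mono)
  then have "8 * W \<le> CARD('d) * (1 - eig N m)"
    by (simp add: sum_subtractf eig_def right_diff_distrib)
  then have gap: "8 / CARD('d) * W \<le> 1 - eig N m"
    by (simp add: field_simps)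
  show "8 / CARD('d) * (\<Prod>i\<in>UNIV. (dist_multiple N (m $ i) / N) powr (2 / CARD('d))) \<le> 1 - eig N m"
    by (rule order_trans[OF mult_left_mono[OF P] gap]) simp
  have "0 < 8 / CARD('d) * W" using Wpos by simp
  then show "eig N m < 1" using gap by linarith
qed

definition heat_const :: "nat \<Rightarrow> real" where
  "heat_const d = 8 * (16 / d) powr (- (5/4)) * 13 ^ d + 1"

lemma heat_const_pos: "0 < heat_const d"
  by (simp add: heat_const_def add_nonneg_pos)

text \<open>
  The exponential decay in \<open>k\<close> times the spectral gap is weakened to a power with exponent \<open>5/4\<close>. As
  \<open>5/4 < d / 2\<close>, the corresponding negative power of the frequency is still integrable at the origin, so
  its average over all frequencies is bounded in \<open>N\<close>.
\<close>

lemma heat_kernel_bound: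
  assumes d: "CARD('d) \<ge> 3" and N: "N \<ge> 1" and k: "k \<ge> 1"
  shows "(\<Sum>m\<in>torus N - {0 :: int ^ 'd}. (eig N m ^ k * (1 + eig N m))\<^sup>2) / real N ^ CARD('d)
    \<le> heat_const CARD('d) * k powr (- (5/4))"
proof -
  let ?d = "CARD('d)"
  define \<beta> where "\<beta> = 5 / (2 * real ?d)"
  define D where "D m i = dist_multiple N ((m :: int ^ 'd) $ i) / N" for m i
  have \<beta>: "0 \<le> \<beta>" "\<beta> \<le> 5/6"
    using d by (auto simp: \<beta>_def field_simps)
  have Dpos: "0 < D m i" for m i using N by (simp add: D_def dist_multiple_def)
  then have D0: "D m i \<noteq> 0" "0 \<le> D m i" for m i by (metis less_irrefl, metis less_imp_le)
  have bnd: "(eig N m ^ k * (1 + eig N m))\<^sup>2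
      \<le> 8 * (16 / ?d) powr (- (5/4)) * k powr (- (5/4)) * (\<Prod>i\<in>UNIV. (1 / D m i) powr \<beta>) + k powr (- (5/4))"
    if m: "m \<in> torus N - {0}" for m :: "int ^ 'd"
  proof -
    define R where "R = (\<Prod>i\<in>UNIV. D m i powr (2 / ?d))"
    have Rpos: "0 < R" unfolding R_def by (intro prod_pos ballI) (simp add: D0)
    have gap: "8 / ?d * R \<le> 1 - eig N m"
      using spectral_gap_lower(1)[of m N] m by (simp add: R_def D_def)
    have "16 * k / ?d * R = 2 * k * (8 / ?d * R)" by simp
    also have "\<dots> \<le> 2 * k * (1 - eig N m)" by (intro mult_left_mono gap) simp
    finally have "exp (- (2 * k * (1 - eig N m))) \<le> exp (- (16 * k / ?d * R))" by simp
    also have "\<dots> \<le> 2 * (16 * k / ?d * R) powr (- (5/4))"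
      using Rpos k by (intro exp_neg_le_powr) auto
    also have "(16 * k / ?d * R) = (16 / ?d) * k * R" by simp
    also have "((16 / ?d) * k * R) powr (- (5/4)) = (16 / ?d) powr (- (5/4)) * k powr (- (5/4)) * R powr (- (5/4))"
      using Rpos by (simp only: powr_mult)
    also have "R powr (- (5/4)) = (\<Prod>i\<in>UNIV. (1 / D m i) powr \<beta>)"
    proof -
      have "R powr (- (5/4)) = (\<Prod>i\<in>UNIV. (D m i powr (2 / ?d)) powr (- (5/4)))"
        unfolding R_def by (simp add: prod_powr_distrib)
      also have "\<dots> = (\<Prod>i\<in>UNIV. (1 / D m i) powr \<beta>)"
      proof (intro prod.cong refl)
        fix i
        have "(D m i powr (2 / ?d)) powr (- (5/4)) = D m i powr (- \<beta>)"
          by (simp add: powr_powr \<beta>_def)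
        also have "\<dots> = (1 / D m i) powr \<beta>"
          using D0 by (simp add: powr_divide powr_minus_divide)
        finally show "(D m i powr (2 / ?d)) powr (- (5/4)) = (1 / D m i) powr \<beta>" .
      qed
      finally show ?thesis .
    qed
    finally have e: "exp (- (2 * k * (1 - eig N m)))
      \<le> 2 * ((16 / ?d) powr (- (5/4)) * k powr (- (5/4)) * (\<Prod>i\<in>UNIV. (1 / D m i) powr \<beta>))" .
    have "1 / (real k)\<^sup>2 = k powr (- 2)" using k by (simp add: powr_minus powr_numeral divide_inverse)
    also have "\<dots> \<le> k powr (- (5/4))" using k by (intro powr_mono) auto
    finally have "1 / (real k)\<^sup>2 \<le> k powr (- (5/4))" .
    moreover have "(eig N m ^ k * (1 + eig N m))\<^sup>2 \<le> 4 * exp (- (2 * k * (1 - eig N m))) + 1 / k\<^sup>2"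
      using abs_eig_le_1[of N m] k by (intro multiplier_bound) auto
    ultimately show ?thesis using e by (simp add: mult_ac)
  qed
  have "(\<Sum>m\<in>torus N - {0}. \<Prod>i\<in>UNIV. (1 / D m i) powr \<beta>) \<le> (\<Sum>m\<in>torus N. \<Prod>i\<in>UNIV. (1 / D m i) powr \<beta>)"
    by (intro sum_mono2 finite_torus prod_nonneg) auto
  also have "\<dots> = (\<Prod>i\<in>(UNIV::'d set). \<Sum>j\<in>{0..<int N}. (N / dist_multiple N j) powr \<beta>)"
    unfolding torus_eq_box D_def by (subst sum_box_prod[symmetric]) simp_all
  also have "\<dots> \<le> (\<Prod>i\<in>(UNIV::'d set). 13 * real N)"
    using sum_dist_multiple[OF N \<beta>] N by (intro prod_mono conjI sum_nonneg) (auto simp: divide_le_eq)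
  finally have sum: "(\<Sum>m\<in>torus N - {0}. \<Prod>i\<in>UNIV. (1 / D m i) powr \<beta>) \<le> 13 ^ ?d * real N ^ ?d"
    by (simp add: power_mult_distrib)
  have card: "real (card (torus N - {0 :: int ^ 'd})) \<le> real N ^ ?d"
    using card_mono[OF finite_torus Diff_subset, of N "{0 :: int ^ 'd}"]
    by (simp add: card_torus flip: of_nat_power)
  have "(\<Sum>m\<in>torus N - {0 :: int ^ 'd}. (eig N m ^ k * (1 + eig N m))\<^sup>2)
      \<le> (\<Sum>m\<in>torus N - {0 :: int ^ 'd}. 8 * (16 / ?d) powr (- (5/4)) * k powr (- (5/4)) * (\<Prod>i\<in>UNIV. (1 / D m i) powr \<beta>) + k powr (- (5/4)))"
    by (intro sum_mono bnd)
  also have "\<dots> = 8 * (16 / ?d) powr (- (5/4)) * k powr (- (5/4)) * (\<Sum>m\<in>torus N - {0}. \<Prod>i\<in>UNIV. (1 / D m i) powr \<beta>)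
      + real (card (torus N - {0 :: int ^ 'd})) * k powr (- (5/4))"
    by (simp add: sum.distrib sum_distrib_left)
  also have "\<dots> \<le> 8 * (16 / ?d) powr (- (5/4)) * k powr (- (5/4)) * (13 ^ ?d * real N ^ ?d) + real N ^ ?d * k powr (- (5/4))"
    using sum card by (intro add_mono mult_left_mono mult_right_mono) auto
  also have "\<dots> = heat_const ?d * k powr (- (5/4)) * real N ^ ?d"
    by (simp add: heat_const_def algebra_simps)
  finally show ?thesis using N by (simp add: divide_le_eq)
qed

corollary slice_torus_bound:
  fixes z :: "int ^ 'd"
  assumes "CARD('d) \<ge> 3" "N \<ge> 1" "k \<ge> 1"
  shows "\<bar>slice N k z - 4 / real N ^ CARD('d)\<bar> \<le> heat_const CARD('d) * k powr (- (5/4))"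
proof -
  have "\<bar>\<Sum>m\<in>torus N - {0}. (eig N m ^ k * (1 + eig N m))\<^sup>2 * cos (phase N m z)\<bar>
      \<le> (\<Sum>m\<in>torus N - {0 :: int ^ 'd}. (eig N m ^ k * (1 + eig N m))\<^sup>2)"
    by (rule order_trans[OF sum_abs]) (intro sum_mono, simp add: abs_mult mult_left_le)
  then have "\<bar>slice N k z - 4 / real N ^ CARD('d)\<bar>
      \<le> (\<Sum>m\<in>torus N - {0 :: int ^ 'd}. (eig N m ^ k * (1 + eig N m))\<^sup>2) / real N ^ CARD('d)"
    using assms by (simp add: slice_fourier_centred divide_right_mono)
  then show ?thesis using heat_kernel_bound[OF assms] by linarith
qed

section \<open>Lattice and torus at short times\<close>

lemma ret_agree_short_time:
  assumes "\<And>i. \<bar>z $ i\<bar> + int n < int N"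
  shows "ret N n z = ret 0 n z"
  using assms
proof (induction n arbitrary: z)
  case 0
  have "int N dvd z $ i \<longleftrightarrow> z $ i = 0" for i
    using 0[of i] zdvd_imp_le[of "int N" "\<bar>z $ i\<bar>"] by auto
  then have "proj N z = 0 \<longleftrightarrow> z = 0" 
    by (simp add: vec_eq_iff mod_eq_0_iff_dvd)
  then show ?case by simp
next
  case (Suc n)
  have "ret N n (z + s) = ret 0 n (z + s)" if "s \<in> unit_steps" for s
  proof (rule Suc.IH)
    show "\<bar>(z + s) $ i\<bar> + int n < int N" for i
      using Suc.prems[of i] unit_steps_bound[OF that, of i] by simp
  qed
  then show ?case by simp
qed

lemma ret_lattice_support:
  assumes "\<bar>z $ i\<bar> > int n"
  shows "ret 0 n z = 0"
  using assms
proof (induction n arbitrary: z)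
  case 0
  then show ?case by auto
next
  case (Suc n)
  have "ret 0 n (z + s) = 0" if "s \<in> unit_steps" for s
    by (rule Suc.IH) (use Suc.prems unit_steps_bound[OF that, of i] in simp)
  then show ?case by simp
qed

lemma slice_nonneg: "0 \<le> slice N k z"
  by (simp add: slice_def del: ret.simps)

text \<open>
  A torus that is too large for the walk to go around has the same return probabilities.
\<close>

lemma slice_lattice_bound:
  fixes z :: "int ^ 'd"
  assumes d: "CARD('d) \<ge> 3" and k: "k \<ge> 1"
  shows "slice 0 k z \<le> (heat_const CARD('d) + 4) * k powr (- (5/4))"
proof -
  define B where "B = Max (range (\<lambda>i. \<bar>z $ i\<bar>))"
  define N where "N = nat B + 2 * k + 3"
  have "\<bar>z $ i\<bar> \<le> B" for i
    unfolding B_def by (rule Max_ge) auto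
  then have zB: "\<bar>z $ i\<bar> \<le> int (nat B)" for i
    by (rule order_trans) simp
  have agree: "ret N n z = ret 0 n z" if "n \<le> 2 * k + 2" for n
  proof (rule ret_agree_short_time)
    show "\<bar>z $ i\<bar> + int n < int N" for i
      using zB[of i] that unfolding N_def by linarith
  qed
  have N: "N \<ge> 1" "N \<ge> k" by (auto simp: N_def)
  have "slice 0 k z = slice N k z"
    using agree by (simp add: slice_def del: ret.simps)
  moreover have "slice N k z \<le> 4 / real N ^ CARD('d) + heat_const CARD('d) * k powr (- (5/4))"
    using slice_torus_bound[OF d N(1) k, of z] by linarith
  moreover have "4 / real N ^ CARD('d) \<le> 4 * k powr (- (5/4))"
  proof -
    have "real k powr (5/4) \<le> real k powr CARD('d)"
      using d k by (intro powr_mono) auto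
    also have "\<dots> = real k ^ CARD('d)" using k by (simp add: powr_realpow)
    also have "\<dots> \<le> real N ^ CARD('d)" using N by (intro power_mono) auto
    finally show ?thesis
      using k by (simp add: powr_minus_divide frac_le)
  qed
  ultimately show ?thesis by (simp add: distrib_right)
qed

lemma summable_powr_5_4: "summable (\<lambda>k. real k powr (- (5/4)))"
  by (subst summable_real_powr_iff) simp

lemma summable_slice_lattice:
  fixes z :: "int ^ 'd"
  assumes d: "CARD('d) \<ge> 3"
  shows "summable (\<lambda>k. slice 0 k z)"
proof (rule summable_comparison_test')
  show "summable (\<lambda>k. (heat_const CARD('d) + 4) * real k powr (- (5/4)))"
    by (intro summable_mult summable_powr_5_4)
  show "norm (slice 0 k z) \<le> (heat_const CARD('d) + 4) * real k powr (- (5/4))" if "1 \<le> k" for k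
    using slice_lattice_bound[OF d that, of z] slice_nonneg[of 0 k z] by simp
qed

subsection \<open>The Green function of the lattice\<close>

text \<open>
  The partial sums of \<open>slice\<close> count each return probability twice, except at both ends.
\<close>

lemma sum_slice: "(\<Sum>k<K. slice N k z) = 2 * (\<Sum>n<2 * K. ret N n z) - ret N 0 z + ret N (2 * K) z"
  by (induction K) (simp_all add: slice_def del: ret.simps)

lemma green_lattice_eq:
  fixes x y :: "int ^ 'd"
  assumes d: "CARD('d) \<ge> 3"
  shows "green_lattice x y = 1/2 * ret 0 0 (x - y) + 1/2 * (\<Sum>k. slice 0 k (x - y))"
proof -
  define z where "z = x - y"
  have summ: "summable (\<lambda>n. ret 0 n z)"
  proof (rule summableI_nonneg_bounded)
    fix n
    have "(\<Sum>n<n. ret 0 n z) \<le> (\<Sum>n<2 * n. ret 0 n z)"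
      by (rule sum_mono2) auto
    also have "2 * \<dots> \<le> (\<Sum>k<n. slice 0 k z) + ret 0 0 z"
      by (simp add: sum_slice del: ret.simps)
    also have "(\<Sum>k<n. slice 0 k z) \<le> (\<Sum>k. slice 0 k z)"
      using slice_nonneg by (intro sum_le_suminf summable_slice_lattice d) auto
    finally show "(\<Sum>n<n. ret 0 n z) \<le> ((\<Sum>k. slice 0 k z) + ret 0 0 z) / 2"
      by (simp del: ret.simps)
  qed simp
  have "(\<lambda>K. (\<Sum>k<K. slice 0 k z)) \<longlonglongrightarrow> 2 * (\<Sum>n. ret 0 n z) - ret 0 0 z + 0"
    unfolding sum_slice
  proof (intro tendsto_intros)
    have sub: "filterlim (\<lambda>K :: nat. 2 * K) at_top sequentially"
      by (rule filterlim_subseq) (simp add: strict_mono_def)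
    show "(\<lambda>K. \<Sum>n<2 * K. ret 0 n z) \<longlonglongrightarrow> (\<Sum>n. ret 0 n z)"
      by (rule filterlim_compose[OF summable_LIMSEQ[OF summ] sub])
    show "(\<lambda>K. ret 0 (2 * K) z) \<longlonglongrightarrow> 0"
      by (rule filterlim_compose[OF summable_LIMSEQ_zero[OF summ] sub])
  qed
  then have "(\<Sum>k. slice 0 k z) = 2 * (\<Sum>n. ret 0 n z) - ret 0 0 z"
    by (metis LIMSEQ_unique add.right_neutral summable_LIMSEQ[OF summable_slice_lattice[OF d]])
  moreover have "green_lattice x y = (\<Sum>n. ret 0 n z)"
    by (simp add: green_lattice_def prob_srw_lattice z_def del: ret.simps)
  ultimately show ?thesis by (simp add: z_def field_simps del: ret.simps)
qed

section \<open>The Green function of the torus\<close>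

lemma space_holding_times [simp]: "space holding_times = UNIV"
  by (simp add: holding_times_def space_PiM)

lemma prob_space_holding_times: "prob_space holding_times"
  unfolding holding_times_def by (intro prob_space_PiM prob_space_exponential_density) simp

lemma holding_times_component:
  "distributed holding_times lborel (\<lambda>\<tau>. \<tau> n) (exponential_density 1)"
proof -
  have "distr holding_times (density lborel (exponential_density 1)) (\<lambda>\<tau>. \<tau> n) = density lborel (exponential_density 1)"
    unfolding holding_times_def
    by (rule distr_PiM_component) (auto intro: prob_space_exponential_density)
  moreover have "distr holding_times (density lborel (exponential_density 1)) (\<lambda>\<tau>. \<tau> n) = distr holding_times lborel (\<lambda>\<tau>. \<tau> n)"
    by (rule distr_cong) auto
  ultimately have "distr holding_times lborel (\<lambda>\<tau>. \<tau> n) = density lborel (exponential_density 1)" by simp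
  moreover have "(\<lambda>\<tau>. \<tau> n) \<in> holding_times \<rightarrow>\<^sub>M density lborel (exponential_density 1)"
    unfolding holding_times_def by (rule measurable_component_singleton) simp
  then have "(\<lambda>\<tau>. \<tau> n) \<in> holding_times \<rightarrow>\<^sub>M lborel"
    by (simp cong: measurable_cong_sets)
  ultimately show ?thesis
    by (simp add: distributed_def)
qed

lemma holding_times_measurable [measurable]: "(\<lambda>\<tau>. \<tau> n) \<in> borel_measurable holding_times"
  using distributed_measurable[OF holding_times_component] by simp

lemma holding_times_partial_sum:
  "distributed holding_times lborel (\<lambda>\<tau>. \<Sum>j\<le>n. \<tau> j) (erlang_density n 1)"
proof -
  interpret prob_space holding_times by (rule prob_space_holding_times)
  have "indep_vars (\<lambda>_. density lborel (exponential_density 1)) (\<lambda>n \<tau>. \<tau> n) UNIV"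
    unfolding holding_times_def
    by (rule indep_vars_coordinates) (auto intro: prob_space_exponential_density)
  then have "indep_vars (\<lambda>_. borel) (\<lambda>n \<tau>. \<tau> n) UNIV"
    by (auto simp: indep_vars_def2)
  then have "indep_vars (\<lambda>_. borel) (\<lambda>n \<tau>. \<tau> n) {..n}"
    by (rule indep_vars_subset) simp
  from exponential_distributed_sum[OF _ _ _ holding_times_component this] show ?thesis
    by simp
qed

lemma prob_partial_sum_le:
  assumes "0 \<le> t"
  shows "measure holding_times {\<tau>. (\<Sum>j\<le>n. \<tau> j) \<le> t} = 1 - (\<Sum>i\<le>n. t ^ i * exp (- t) / fact i)"
  using prob_space.erlang_distributed_le[OF prob_space_holding_times holding_times_partial_sum _ assms, of n] assms
  by (simp add: erlang_CDF_def)

text \<open>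
  An infinite number of jumps up to time \<open>t\<close> would be counted as zero jumps; the third hypothesis
  excludes this.
\<close>

lemma jump_count_eq_iff:
  assumes pos: "\<And>n. 0 < \<tau> n" and "0 \<le> t" and t: "t < (\<Sum>j\<le>m. \<tau> j)"
  shows "jump_count \<tau> t = n \<longleftrightarrow> (\<Sum>j<n. \<tau> j) \<le> t \<and> t < (\<Sum>j\<le>n. \<tau> j)"
proof -
  define S where "S n = (\<Sum>j\<le>n. \<tau> j)" for n
  have mono: "mono S" unfolding mono_iff_le_Suc S_def using pos by (simp add: less_imp_le)
  define J where "J = (LEAST n. t < S n)"
  have J: "t < S J" unfolding J_def by (rule LeastI[of _ m]) (use t in \<open>simp add: S_def\<close>)
  have less: "S n \<le> t \<longleftrightarrow> n < J" for n
  proof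
    show "S n \<le> t \<Longrightarrow> n < J"
      using J monoD[OF mono, of J n] by (cases "n < J") auto
    show "n < J \<Longrightarrow> S n \<le> t"
      unfolding J_def by (drule not_less_Least) simp
  qed
  have "jump_count \<tau> t = J"
    unfolding jump_count_def S_def[symmetric] less by simp
  moreover have "J = n \<longleftrightarrow> (n = 0 \<or> S (n - 1) \<le> t) \<and> t < S n"
    unfolding less not_le[symmetric] by (cases n) auto
  moreover have "(n = 0 \<or> S (n - 1) \<le> t) \<longleftrightarrow> (\<Sum>j<n. \<tau> j) \<le> t"
    using \<open>0 \<le> t\<close> by (cases n) (simp_all add: S_def lessThan_Suc_atMost)
  ultimately show ?thesis
    by (simp add: S_def)
qed

text \<open>
  A positive value \<open>Suc n\<close> means that the set of jumps is one of countably many finite sets. The value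
  \<open>0\<close>, which also stands for infinite sets, is what remains.
\<close>

lemma measurable_jump_count [measurable]:
  "(\<lambda>\<tau>. jump_count \<tau> t) \<in> holding_times \<rightarrow>\<^sub>M count_space UNIV"
proof -
  let ?S = "\<lambda>\<tau>. {n. (\<Sum>j\<le>n. \<tau> j) \<le> t}"
  have Suc: "jump_count \<tau> t = Suc n \<longleftrightarrow> (\<exists>F\<in>{F. finite F \<and> card F = Suc n}. \<forall>k. k \<in> F \<longleftrightarrow> (\<Sum>j\<le>k. \<tau> j) \<le> t)" for \<tau> n
  proof
    assume *: "jump_count \<tau> t = Suc n"
    then have "finite (?S \<tau>)"
      unfolding jump_count_def by (intro card_ge_0_finite) simp
    with * show "\<exists>F\<in>{F. finite F \<and> card F = Suc n}. \<forall>k. k \<in> F \<longleftrightarrow> (\<Sum>j\<le>k. \<tau> j) \<le> t"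
      by (intro bexI[of _ "?S \<tau>"]) (auto simp: jump_count_def)
  next
    assume "\<exists>F\<in>{F. finite F \<and> card F = Suc n}. \<forall>k. k \<in> F \<longleftrightarrow> (\<Sum>j\<le>k. \<tau> j) \<le> t"
    then obtain F where "card F = Suc n" "\<forall>k. k \<in> F \<longleftrightarrow> (\<Sum>j\<le>k. \<tau> j) \<le> t" by auto
    moreover from this have "F = ?S \<tau>" by auto
    ultimately show "jump_count \<tau> t = Suc n" by (simp add: jump_count_def)
  qed
  have "countable {F :: nat set. finite F \<and> card F = Suc n}" for n
    by (rule countable_subset[OF _ countable_Collect_finite]) auto
  then have [measurable]: "Measurable.pred holding_times (\<lambda>\<tau>. jump_count \<tau> t = Suc n)" for n
    unfolding Suc by measurable
  have "jump_count \<tau> t = 0 \<longleftrightarrow> (\<forall>n. jump_count \<tau> t \<noteq> Suc n)" for \<tau>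
    by (cases "jump_count \<tau> t") auto
  then have "Measurable.pred holding_times (\<lambda>\<tau>. jump_count \<tau> t = n)" for n
    by (cases n) simp_all
  then show ?thesis
    by (intro measurable_count_space_eq_countable[THEN iffD2]) (auto simp: pred_def vimage_def)
qed

lemma AE_holding_times_pos: "AE \<tau> in holding_times. \<forall>n. 0 < \<tau> n"
proof -
  have "AE \<tau> in holding_times. 0 < \<tau> n" for n
  proof (subst prob_space.distributed_AE2[OF prob_space_holding_times holding_times_component])
    show "AE x in lborel. 0 < ennreal (exponential_density 1 x) \<longrightarrow> 0 < x"
      using AE_lborel_singleton[of 0] by eventually_elim (auto simp: exponential_density_def)
  qed simp
  then show ?thesis by (simp add: AE_all_countable)
qed

lemma poisson_sums: "(\<lambda>i. t ^ i * exp (- t) / fact i) sums 1" for t :: real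
proof -
  have "(\<lambda>i. (t ^ i /\<^sub>R fact i) * exp (- t)) sums (exp t * exp (- t))"
    by (intro sums_mult2 exp_converges)
  then show ?thesis by (simp add: exp_minus divide_inverse mult_ac)
qed

lemma AE_holding_times_unbounded:
  assumes "0 \<le> t"
  shows "AE \<tau> in holding_times. \<exists>m. t < (\<Sum>j\<le>m. \<tau> j)"
proof -
  interpret prob_space holding_times by (rule prob_space_holding_times)
  let ?B = "{\<tau>. \<forall>m. (\<Sum>j\<le>m. \<tau> j) \<le> t}"
  have "(\<lambda>m. \<Sum>i<Suc m. t ^ i * exp (- t) / fact i) \<longlonglongrightarrow> 1"
    using poisson_sums[of t] unfolding sums_def by (rule LIMSEQ_Suc)
  then have lim: "(\<lambda>m. 1 - (\<Sum>i\<le>m. t ^ i * exp (- t) / fact i)) \<longlonglongrightarrow> 1 - 1"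
    unfolding lessThan_Suc_atMost by (intro tendsto_intros)
  have "{\<tau> \<in> space holding_times. \<forall>m. (\<Sum>j\<le>m. \<tau> j) \<le> t} \<in> sets holding_times"
    by measurable
  then have B: "?B \<in> sets holding_times" by simp
  have "prob ?B \<le> 1 - (\<Sum>i\<le>m. t ^ i * exp (- t) / fact i)" for m
    unfolding prob_partial_sum_le[OF assms, symmetric]
  proof (rule finite_measure_mono)
    have "{\<tau> \<in> space holding_times. (\<Sum>j\<le>m. \<tau> j) \<le> t} \<in> events" by measurable
    then show "{\<tau>. (\<Sum>j\<le>m. \<tau> j) \<le> t} \<in> events" by simp
  qed auto
  then have "prob ?B \<le> 0"
    using LIMSEQ_le_const[OF lim, of "prob ?B"] by auto
  then have "prob ?B = 0" by (simp add: measure_le_0_iff)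
  then have "emeasure holding_times ?B = 0" by (simp add: emeasure_eq_measure)
  then show ?thesis
    by (intro AE_I[where N="?B"]) (auto simp: not_less B)
qed

text \<open>
  Up to a null set, \<open>n\<close> jumps means that the \<open>n\<close>-th arrival is at most \<open>t\<close> and the next one is not; both
  arrival times have Erlang laws.
\<close>

lemma prob_jump_count:
  assumes t: "0 \<le> t"
  shows "measure holding_times {\<tau>. jump_count \<tau> t = n} = t ^ n * exp (- t) / fact n"
proof -
  interpret prob_space holding_times by (rule prob_space_holding_times)
  define A where "A n = {\<tau> :: nat \<Rightarrow> real. (\<Sum>j<n. \<tau> j) \<le> t}" for n
  have [measurable]: "A n \<in> events" for n
  proof -
    have "{\<tau> \<in> space holding_times. (\<Sum>j<n. \<tau> j) \<le> t} \<in> events" by measurable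
    then show ?thesis by (simp add: A_def)
  qed
  have PA: "prob (A n) = 1 - (\<Sum>i<n. t ^ i * exp (- t) / fact i)" for n
  proof (cases n)
    case 0
    then show ?thesis using t prob_space by (simp add: A_def)
  next
    case (Suc m)
    then show ?thesis
      using prob_partial_sum_le[OF t, of m] by (simp add: A_def lessThan_Suc_atMost del: sum.lessThan_Suc)
  qed
  have "{\<tau>. jump_count \<tau> t = n} \<in> events"
    using measurable_sets[OF measurable_jump_count, of "{n}" t] by (simp add: vimage_def)
  moreover have "AE \<tau> in holding_times. \<tau> \<in> {\<tau>. jump_count \<tau> t = n} \<longleftrightarrow> \<tau> \<in> A n - A (Suc n)"
    using AE_holding_times_pos AE_holding_times_unbounded[OF t]
  proof eventually_elim
    case (elim \<tau>)
    then obtain m where "t < (\<Sum>j\<le>m. \<tau> j)" by auto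
    from jump_count_eq_iff[OF _ t this] elim show ?case
      by (auto simp: A_def lessThan_Suc_atMost simp del: sum.lessThan_Suc)
  qed
  ultimately have "prob {\<tau>. jump_count \<tau> t = n} = prob (A n - A (Suc n))"
    by (intro measure_eq_AE) auto
  also have "\<dots> = prob (A n) - prob (A n \<inter> A (Suc n))"
    by (rule finite_measure_Diff') auto
  also have "prob (A n \<inter> A (Suc n)) = prob (A (Suc n))"
  proof (rule measure_eq_AE)
    show "AE \<tau> in holding_times. \<tau> \<in> A n \<inter> A (Suc n) \<longleftrightarrow> \<tau> \<in> A (Suc n)"
      using AE_holding_times_pos
    proof eventually_elim
      case (elim \<tau>)
      then have "0 < \<tau> n" by simp
      then show ?case by (auto simp: A_def)
    qed
  qed auto
  finally show ?thesis by (simp add: PA)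
qed

lemma prob_ctrw_torus:
  assumes t: "0 \<le> t" and xy: "x \<in> torus N" "y \<in> torus N"
  shows "(\<lambda>n. t ^ n * exp (- t) / fact n * ret N n (x - y)) sums
    measure (increments \<Otimes>\<^sub>M holding_times) {\<omega> \<in> space (increments \<Otimes>\<^sub>M holding_times). ctrw_torus N x \<omega> t = y}"
proof -
  interpret I: prob_space increments by (rule prob_space_increments)
  interpret H: prob_space holding_times by (rule prob_space_holding_times)
  interpret P: pair_prob_space increments holding_times ..
  let ?R = "\<lambda>n. {\<xi>. srw_torus N x \<xi> n = y} \<times> {\<tau>. jump_count \<tau> t = n}"
  have m1: "{\<xi>. srw_torus N x \<xi> n = y} \<in> sets increments" for n
    using measurable_sets[OF measurable_srw_torus, of "{y}" N x n] by (simp add: vimage_def)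
  have m2: "{\<tau>. jump_count \<tau> t = n} \<in> sets holding_times" for n
    using measurable_sets[OF measurable_jump_count, of "{n}" t] by (simp add: vimage_def)
  have "(\<lambda>n. P.prob (?R n)) sums P.prob (\<Union>n. ?R n)"
    using m1 m2 by (intro P.finite_measure_UNION) (auto simp: disjoint_family_on_def)
  moreover have "P.prob (?R n) = t ^ n * exp (- t) / fact n * ret N n (x - y)" for n
  proof -
    have "emeasure (increments \<Otimes>\<^sub>M holding_times) (?R n)
        = emeasure increments {\<xi>. srw_torus N x \<xi> n = y} * emeasure holding_times {\<tau>. jump_count \<tau> t = n}"
      by (rule H.emeasure_pair_measure_Times[OF m1 m2])
    then show ?thesis
      using t by (simp add: P.emeasure_eq_measure I.emeasure_eq_measure H.emeasure_eq_measure
          prob_srw_torus[OF xy] prob_jump_count flip: ennreal_mult)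
  qed
  moreover have "(\<Union>n. ?R n) = {\<omega> \<in> space (increments \<Otimes>\<^sub>M holding_times). ctrw_torus N x \<omega> t = y}"
    by (auto simp: ctrw_torus_def space_pair_measure)
  ultimately show ?thesis by simp
qed

lemma prob_ctrw_torus_fourier:
  fixes x y :: "int ^ 'd"
  assumes N: "N \<ge> 1" and t: "0 \<le> t" and xy: "x \<in> torus N" "y \<in> torus N"
  shows "measure (increments \<Otimes>\<^sub>M holding_times) {\<omega> \<in> space (increments \<Otimes>\<^sub>M holding_times). ctrw_torus N x \<omega> t = y}
    - 1 / real N ^ CARD('d)
    = (\<Sum>m\<in>torus N - {0}. exp (- ((1 - eig N m) * t)) * (cos (phase N m (x - y)) / real N ^ CARD('d)))"
proof -
  let ?c = "\<lambda>m. cos (phase N m (x - y)) / real N ^ CARD('d)"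
  have "(\<lambda>n. ((t * eig N m) ^ n /\<^sub>R fact n) * (exp (- t) * ?c m)) sums (exp (t * eig N m) * (exp (- t) * ?c m))" for m
    by (intro sums_mult2 exp_converges)
  then have "(\<lambda>n. t ^ n * exp (- t) / fact n * (eig N m ^ n * ?c m)) sums (exp (- ((1 - eig N m) * t)) * ?c m)" for m
    by (simp add: algebra_simps exp_diff exp_minus divide_inverse power_mult_distrib)
  then have "(\<lambda>n. \<Sum>m\<in>torus N. t ^ n * exp (- t) / fact n * (eig N m ^ n * ?c m)) sums (\<Sum>m\<in>torus N. exp (- ((1 - eig N m) * t)) * ?c m)"
    by (intro sums_sum)
  then have "(\<lambda>n. t ^ n * exp (- t) / fact n * ret N n (x - y)) sums (\<Sum>m\<in>torus N. exp (- ((1 - eig N m) * t)) * ?c m)"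
    by (simp add: ret_fourier[OF N] sum_distrib_left sum_divide_distrib)
  from sums_unique2[OF prob_ctrw_torus[OF t xy] this] show ?thesis
    by (simp add: sum.remove[OF finite_torus zero_in_torus[OF N]])
qed

lemma has_integral_exp_neg:
  assumes "0 < (a::real)"
  shows "has_bochner_integral lborel (\<lambda>t. indicator {0..} t * exp (- (a * t))) (1 / a)"
proof (rule has_bochner_integral_nn_integral)
  have lim: "((\<lambda>t. - exp (- (a * t)) / a) \<longlongrightarrow> 0) at_top"
    using assms by real_asymp
  have "(\<integral>\<^sup>+t. ennreal (exp (- (a * t))) * indicator {0..} t \<partial>lborel) = ennreal (0 - - exp (- (a * 0)) / a)"
    using assms by (intro nn_integral_FTC_atLeast lim) (auto intro!: derivative_eq_intros)
  then show "(\<integral>\<^sup>+t. ennreal (indicator {0..} t * exp (- (a * t))) \<partial>lborel) = ennreal (1 / a)"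
    by (simp add: indicator_mult_ennreal mult.commute)
qed (use assms in auto)

text \<open>
  Only the zero frequency has eigenvalue \<open>1\<close>, and the centring removes it. Every other frequency
  decays exponentially in \<open>t\<close> and can be integrated by itself.
\<close>

lemma green_torus_fourier:
  fixes x y :: "int ^ 'd"
  assumes N: "N \<ge> 1" and xy: "x \<in> torus N" "y \<in> torus N"
  shows "green_torus N x y
    = (\<Sum>m\<in>torus N - {0}. 1 / (1 - eig N m) * cos (phase N m (x - y))) / real N ^ CARD('d)"
proof -
  let ?c = "\<lambda>m. cos (phase N m (x - y)) / real N ^ CARD('d)"
  have "green_torus N x y = (\<integral>t. (\<Sum>m\<in>torus N - {0}. (indicator {0..} t * exp (- ((1 - eig N m) * t))) * ?c m) \<partial>lborel)"
    unfolding green_torus_def set_lebesgue_integral_def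
  proof (intro Bochner_Integration.integral_cong refl)
    fix t :: real
    show "indicator {0..} t *\<^sub>R (measure (increments \<Otimes>\<^sub>M holding_times) {\<omega> \<in> space (increments \<Otimes>\<^sub>M holding_times). ctrw_torus N x \<omega> t = y}
        - 1 / real N ^ CARD('d)) = (\<Sum>m\<in>torus N - {0}. (indicator {0..} t * exp (- ((1 - eig N m) * t))) * ?c m)"
      by (cases "0 \<le> t") (simp_all only: prob_ctrw_torus_fourier[OF N _ xy], simp_all)
  qed
  also have "\<dots> = (\<Sum>m\<in>torus N - {0}. 1 / (1 - eig N m) * ?c m)"
    by (intro has_bochner_integral_integral_eq has_bochner_integral_sum has_bochner_integral_mult_left
        has_integral_exp_neg) (use spectral_gap_lower(2) in auto)
  finally show ?thesis by (simp add: sum_divide_distrib)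
qed

text \<open>
  This exhibits the Green operator as a sum of squares. The value \<open>l = -1\<close> is an eigenvalue when \<open>N\<close>
  is even; the geometric series has no limit there, but the factor \<open>1 + l\<close> vanishes.
\<close>

lemma resolvent_sum_of_squares:
  assumes "-1 \<le> l" "l < (1::real)"
  shows "(\<lambda>k. (l ^ k * (1 + l))\<^sup>2) sums (2 / (1 - l) - 1)"
proof (cases "l = -1")
  case True
  then show ?thesis by simp
next
  case False
  then have "\<bar>l\<bar> < 1" using assms by auto
  then have "l\<^sup>2 < 1" by (simp add: abs_square_less_1)
  then have "(\<lambda>k. (l\<^sup>2) ^ k * (1 + l)\<^sup>2) sums (1 / (1 - l\<^sup>2) * (1 + l)\<^sup>2)"
    by (intro sums_mult2 geometric_sums) simp
  moreover have "1 / (1 - l\<^sup>2) * (1 + l)\<^sup>2 = 2 / (1 - l) - 1"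
  proof -
    have "1 - l\<^sup>2 = (1 - l) * (1 + l)" by (simp add: power2_eq_square algebra_simps)
    then have "1 / (1 - l\<^sup>2) * (1 + l)\<^sup>2 = (1 + l) / (1 - l)"
      using False assms by (simp add: power2_eq_square)
    also have "\<dots> = 2 / (1 - l) - 1" using assms by (simp add: field_simps)
    finally show ?thesis .
  qed
  moreover have "(l\<^sup>2) ^ k * (1 + l)\<^sup>2 = (l ^ k * (1 + l))\<^sup>2" for k
    by (simp add: power_mult_distrib mult.commute flip: power_mult)
  ultimately show ?thesis by simp
qed

lemma green_torus_eq:
  fixes x y :: "int ^ 'd"
  assumes N: "N \<ge> 1" and xy: "x \<in> torus N" "y \<in> torus N"
  shows "green_torus N x y = 1/2 * (ret N 0 (x - y) - 1 / real N ^ CARD('d))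
    + 1/2 * (\<Sum>k. slice N k (x - y) - 4 / real N ^ CARD('d))"
proof -
  let ?c = "\<lambda>m. cos (phase N m (x - y))" and ?V = "real N ^ CARD('d)"
  have "(\<lambda>k. (\<Sum>m\<in>torus N - {0}. (eig N m ^ k * (1 + eig N m))\<^sup>2 * ?c m) / ?V) sums
      ((\<Sum>m\<in>torus N - {0}. (2 / (1 - eig N m) - 1) * ?c m) / ?V)"
    using spectral_gap_lower(2) abs_eig_le_1
    by (intro sums_divide sums_sum sums_mult2 resolvent_sum_of_squares) (auto simp: abs_le_iff minus_le_iff)
  then have "(\<Sum>k. slice N k (x - y) - 4 / ?V) = (\<Sum>m\<in>torus N - {0}. (2 / (1 - eig N m) - 1) * ?c m) / ?V"
    unfolding slice_fourier_centred[OF N] by (rule sums_unique[symmetric])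
  also have "\<dots> = 2 * green_torus N x y - (\<Sum>m\<in>torus N - {0}. ?c m) / ?V"
    by (simp add: green_torus_fourier[OF N xy] left_diff_distrib sum_subtractf diff_divide_distrib sum_distrib_left)
  also have "(\<Sum>m\<in>torus N - {0}. ?c m) / ?V = ret N 0 (x - y) - 1 / ?V"
    using ret_fourier[OF N, of 0 "x - y"]
    by (simp add: sum.remove[OF finite_torus zero_in_torus[OF N]] add_divide_distrib del: ret.simps)
  finally show ?thesis by (simp add: field_simps del: ret.simps)
qed

section \<open>The joint covariance\<close>

text \<open>
  These representatives of the torus contain every \<open>box_lattice N \<delta>\<close> in their interior.
\<close>

definition centred_box :: "nat \<Rightarrow> (int ^ 'd) set" where
  "centred_box N = {z. \<forall>i. - int N < 2 * z $ i \<and> 2 * z $ i \<le> int N}"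

lemma centred_residue_unique:
  assumes "N \<ge> 1"
  shows "\<exists>!j. (- int N < 2 * j \<and> 2 * j \<le> int N) \<and> j mod int N = a mod int N"
proof (rule ex_ex1I)
  define b where "b = a mod int N"
  have b: "0 \<le> b" "b < int N" "b mod int N = b" using assms by (auto simp: b_def)
  show "\<exists>j. (- int N < 2 * j \<and> 2 * j \<le> int N) \<and> j mod int N = a mod int N"
  proof (cases "2 * b \<le> int N")
    case True
    with b show ?thesis by (intro exI[of _ b]) (auto simp: b_def)
  next
    case False
    have "(b - int N) mod int N = b" using b by simp
    with b False show ?thesis by (intro exI[of _ "b - int N"]) (auto simp: b_def)
  qed
next
  fix j j'
  assume j: "(- int N < 2 * j \<and> 2 * j \<le> int N) \<and> j mod int N = a mod int N"
    and j': "(- int N < 2 * j' \<and> 2 * j' \<le> int N) \<and> j' mod int N = a mod int N"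
  then have "int N dvd j - j'" by (simp add: mod_eq_dvd_iff[symmetric])
  moreover have "\<bar>j - j'\<bar> < int N" using j j' by linarith
  ultimately show "j = j'" using zdvd_imp_le[of "int N" "\<bar>j - j'\<bar>"] by (cases "j = j'") auto
qed

lemma centred_box_transversal:
  assumes "N \<ge> 1"
  shows "\<exists>!z. z \<in> centred_box N \<and> proj N z = proj N y"
proof -
  have "\<forall>i. \<exists>!j. (- int N < 2 * j \<and> 2 * j \<le> int N) \<and> j mod int N = y $ i mod int N"
    using centred_residue_unique[OF assms] by blast
  then obtain f where f: "\<And>i. (- int N < 2 * f i \<and> 2 * f i \<le> int N) \<and> f i mod int N = y $ i mod int N"
    and u: "\<And>i j. (- int N < 2 * j \<and> 2 * j \<le> int N) \<and> j mod int N = y $ i mod int N \<Longrightarrow> j = f i"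
    by metis
  show ?thesis
  proof (rule ex1I[of _ "vec_lambda f"])
    show "vec_lambda f \<in> centred_box N \<and> proj N (vec_lambda f) = proj N y"
      using f by (simp add: centred_box_def vec_eq_iff)
    show "z = vec_lambda f" if "z \<in> centred_box N \<and> proj N z = proj N y" for z
      using that u by (simp add: centred_box_def vec_eq_iff)
  qed
qed

lemma card_centred_box:
  assumes "N \<ge> 1"
  shows "card (centred_box N :: (int ^ 'd) set) = N ^ CARD('d)"
proof -
  have "bij_betw (proj N) (centred_box N) (torus N :: (int ^ 'd) set)"
    unfolding bij_betw_def
  proof
    show "inj_on (proj N) (centred_box N :: (int ^ 'd) set)"
      using centred_box_transversal[OF assms] by (auto simp: inj_on_def)
    show "proj N ` centred_box N = (torus N :: (int ^ 'd) set)"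
    proof
      show "proj N ` centred_box N \<subseteq> (torus N :: (int ^ 'd) set)"
        using proj_in_torus[OF assms] by auto
      show "torus N \<subseteq> proj N ` (centred_box N :: (int ^ 'd) set)"
      proof
        fix y :: "int ^ 'd" assume "y \<in> torus N"
        then have "proj N y = y" by (rule proj_torus)
        moreover obtain z where "z \<in> centred_box N" "proj N z = proj N y"
          using centred_box_transversal[OF assms, of y] by auto
        ultimately show "y \<in> proj N ` centred_box N" by (metis imageI)
      qed
    qed
  qed
  then show ?thesis using bij_betw_same_card card_torus by metis
qed

lemma finite_centred_box [simp]: "finite (centred_box N)"
proof (rule finite_subset)
  show "centred_box N \<subseteq> {m :: int ^ 'a. \<forall>i. m $ i \<in> {- int N..int N}}"
    by (auto simp: centred_box_def) (smt (verit))+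
qed (rule finite_box, simp)

text \<open>
  For \<open>N \<ge> 1\<close> the second hypothesis is met by any set of representatives of \<open>(\<int>/N)\<^sup>d\<close>. For \<open>N = 0\<close> it
  says that \<open>F\<close> contains the sup-norm ball of radius \<open>m\<close> around \<open>x\<close>, where the lattice walk is at time \<open>m\<close>.
\<close>

lemma chapman_kolmogorov:
  assumes F: "finite F"
    and reps: "\<And>y. (\<And>i. \<bar>y $ i - x $ i\<bar> \<le> int m) \<Longrightarrow> \<exists>!z. z \<in> F \<and> proj N z = proj N y"
  shows "(\<Sum>z\<in>F. ret N m (x - z) * ret N n (z - w)) = ret N (m + n) (x - w)"
    and "(\<Sum>z\<in>F. ret N m (x - z)) = 1"
proof -
  have gen: "(\<Sum>z\<in>F. ret N m (x - z) * ret N n (z - w)) = ret N (m + n) (x - w)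
      \<and> (\<Sum>z\<in>F. ret N m (x - z)) = 1"
    using reps
  proof (induction m arbitrary: x)
    case 0
    obtain z0 where z0: "z0 \<in> F" "proj N z0 = proj N x"
      and u: "\<And>z. z \<in> F \<Longrightarrow> proj N z = proj N x \<Longrightarrow> z = z0"
      using 0[of x] by auto
    have eq: "ret N 0 (x - z) = of_bool (z = z0)" if "z \<in> F" for z
    proof -
      have "proj N (x - z) = 0 \<longleftrightarrow> z = z0"
        using z0 u[OF that] by (metis proj_eq_iff_diff)
      then show ?thesis by simp
    qed
    have "proj N (z0 - w) = proj N (x - w)" 
      using z0 proj_eq_shift[of N z0 x "- w"] by simp
    then have "ret N n (z0 - w) = ret N n (x - w)" by (rule ret_cong_proj)
    with z0 F show ?case
      by (simp add: eq of_bool_def if_distrib[of "\<lambda>x. x * _"] del: ret.simps cong: if_cong)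
  next
    case (Suc m)
    have IH: "(\<Sum>z\<in>F. ret N m (x + s - z) * ret N n (z - w)) = ret N (m + n) (x + s - w)
        \<and> (\<Sum>z\<in>F. ret N m (x + s - z)) = 1" if s: "s \<in> unit_steps" for s
    proof (rule Suc.IH)
      fix y assume y: "\<And>i. \<bar>y $ i - (x + s) $ i\<bar> \<le> int m"
      have "\<bar>y $ i - x $ i\<bar> \<le> int (Suc m)" for i
        using y[of i] unit_steps_bound[OF s, of i] by simp
      then show "\<exists>!z. z \<in> F \<and> proj N z = proj N y" by (rule Suc.prems)
    qed
    have shift: "x - z + s = x + s - z" for z s :: "int ^ 'a" by simp
    have "(\<Sum>z\<in>F. ret N (Suc m) (x - z) * g z)
        = (\<Sum>s\<in>unit_steps. \<Sum>z\<in>F. ret N m (x + s - z) * g z) / (2 * CARD('a))" for g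
    proof -
      have "(\<Sum>z\<in>F. ret N (Suc m) (x - z) * g z)
          = (\<Sum>z\<in>F. (\<Sum>s\<in>unit_steps. ret N m (x + s - z) * g z) / (2 * CARD('a)))"
        by (simp add: shift sum_distrib_right)
      also have "\<dots> = (\<Sum>z\<in>F. \<Sum>s\<in>unit_steps. ret N m (x + s - z) * g z) / (2 * CARD('a))"
        by (rule sum_divide_distrib[symmetric])
      finally show ?thesis by (subst sum.swap)
    qed
    from this[of "\<lambda>z. ret N n (z - w)"] this[of "\<lambda>_. 1"] show ?case
      by (simp add: IH shift card_unit_steps)
  qed
  then show "(\<Sum>z\<in>F. ret N m (x - z) * ret N n (z - w)) = ret N (m + n) (x - w)"
    "(\<Sum>z\<in>F. ret N m (x - z)) = 1" by auto
qed

lemma ret_le_1: "ret N n z \<le> 1"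
proof (induction n arbitrary: z)
  case (Suc n)
  have "(\<Sum>s\<in>unit_steps. ret N n (z + s)) \<le> (\<Sum>s\<in>(unit_steps :: (int ^ 'a) set). 1)"
    by (intro sum_mono Suc)
  then show ?case by (simp add: card_unit_steps divide_le_eq)
qed simp

subsection \<open>Feature vectors\<close>

text \<open>
  The kernels whose squares sum to twice the Green function: the identity, then
  \<open>P ^ k + P ^ (k + 1)\<close>. Those of index \<open>k\<close> have range \<open>k\<close>.
\<close>

primrec root_kernel :: "nat \<Rightarrow> nat \<Rightarrow> int ^ 'd \<Rightarrow> real" where
  "root_kernel N 0 z = ret N 0 z"
| "root_kernel N (Suc k) z = ret N k z + ret N (Suc k) z"

primrec root_mass :: "nat \<Rightarrow> real" where
  "root_mass 0 = 1"
| "root_mass (Suc k) = 2"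

primrec green_term :: "nat \<Rightarrow> nat \<Rightarrow> int ^ 'd \<Rightarrow> real" where
  "green_term N 0 z = ret N 0 z"
| "green_term N (Suc k) z = slice N k z"

lemmas [simp del] = ret.simps

text \<open>
  Torus sites are indexed by \<open>Inl\<close>, lattice sites by \<open>Inr\<close>. The torus walk is unfolded onto
  the representatives in \<open>centred_box N\<close>, so that both families of vectors live on \<open>\<int>\<^sup>d\<close>;
  their inner products define the coupling.
\<close>

primrec feature :: "nat \<Rightarrow> nat \<Rightarrow> int ^ 'd + int ^ 'd \<Rightarrow> int ^ 'd \<Rightarrow> real" where
  "feature N k (Inl u) z =
     (if z \<in> centred_box N then root_kernel N k (u - z) - root_mass k / real N ^ CARD('d) else 0)"
| "feature N k (Inr x) z = root_kernel 0 k (x - z)"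

definition gram :: "nat \<Rightarrow> nat \<Rightarrow> int ^ 'd + int ^ 'd \<Rightarrow> int ^ 'd + int ^ 'd \<Rightarrow> real" where
  "gram N k a b = (\<Sum>z | feature N k a z \<noteq> 0. feature N k a z * feature N k b z)"

lemma finite_sup_ball: "finite {z :: int ^ 'd. \<forall>i. \<bar>x $ i - z $ i\<bar> \<le> r}"
proof (rule finite_subset)
  define M where "M = Max (range (\<lambda>i. \<bar>x $ i\<bar>)) + \<bar>r\<bar>"
  have M: "\<bar>x $ i\<bar> + \<bar>r\<bar> \<le> M" for i unfolding M_def by (intro add_mono Max_ge) auto
  show "{z. \<forall>i. \<bar>x $ i - z $ i\<bar> \<le> r} \<subseteq> {z. \<forall>i. z $ i \<in> {-M..M}}"
  proof safe
    fix z i assume "\<forall>i. \<bar>x $ i - z $ i\<bar> \<le> r"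
    then have "\<bar>x $ i - z $ i\<bar> \<le> r" by blast
    with M[of i] show "z $ i \<in> {-M..M}" by auto
  qed
qed (rule finite_box, simp)

lemma root_kernel_lattice_support:
  assumes "root_kernel 0 k z \<noteq> 0"
  shows "\<bar>z $ i\<bar> \<le> int k"
proof (rule ccontr)
  assume "\<not> \<bar>z $ i\<bar> \<le> int k"
  then have "ret 0 n z = 0" if "n \<le> k" for n
    using that by (intro ret_lattice_support[of _ z i]) auto
  then have "root_kernel 0 k z = 0" by (cases k) auto
  with assms show False by simp
qed

lemma finite_support_feature: "finite {z. feature N k a z \<noteq> 0}"
proof (cases a)
  case (Inl u)
  have "{z. feature N k a z \<noteq> 0} \<subseteq> centred_box N" using Inl by auto
  then show ?thesis by (rule finite_subset) simp
next
  case (Inr x)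
  have "{z. feature N k a z \<noteq> 0} \<subseteq> {z. \<forall>i. \<bar>x $ i - z $ i\<bar> \<le> int k}"
  proof safe
    fix z i assume "feature N k a z \<noteq> 0"
    then show "\<bar>x $ i - z $ i\<bar> \<le> int k"
      using root_kernel_lattice_support[of k "x - z" i] Inr by simp
  qed
  then show ?thesis by (rule finite_subset) (rule finite_sup_ball)
qed

lemma gram_superset:
  assumes "finite F" "\<And>z. feature N k a z \<noteq> 0 \<Longrightarrow> feature N k b z \<noteq> 0 \<Longrightarrow> z \<in> F"
  shows "gram N k a b = (\<Sum>z\<in>F. feature N k a z * feature N k b z)"
proof -
  let ?S = "{z. feature N k a z \<noteq> 0}"
  have "gram N k a b = (\<Sum>z\<in>?S \<inter> F. feature N k a z * feature N k b z)"
    unfolding gram_def using assms finite_support_feature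
    by (intro sum.mono_neutral_right) auto
  also have "\<dots> = (\<Sum>z\<in>F. feature N k a z * feature N k b z)"
    using assms by (intro sum.mono_neutral_left) auto
  finally show ?thesis .
qed

lemma gram_sym: "gram N k a b = gram N k b a"
proof -
  let ?F = "{z. feature N k a z \<noteq> 0} \<union> {z. feature N k b z \<noteq> 0}"
  have "gram N k a b = (\<Sum>z\<in>?F. feature N k a z * feature N k b z)"
    by (rule gram_superset) (auto simp: finite_support_feature)
  moreover have "gram N k b a = (\<Sum>z\<in>?F. feature N k b z * feature N k a z)"
    by (rule gram_superset) (auto simp: finite_support_feature)
  ultimately show ?thesis by (simp add: mult.commute)
qed

lemma gram_form_nonneg:
  assumes A: "finite A"
  shows "0 \<le> (\<Sum>a\<in>A. \<Sum>b\<in>A. c a * c b * gram N k a b)"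
proof -
  define F where "F = (\<Union>a\<in>A. {z. feature N k a z \<noteq> 0})"
  have F: "finite F" unfolding F_def using A finite_support_feature by blast
  have "gram N k a b = (\<Sum>z\<in>F. feature N k a z * feature N k b z)" if "a \<in> A" for a b
    using that by (intro gram_superset F) (auto simp: F_def)
  then have "(\<Sum>a\<in>A. \<Sum>b\<in>A. c a * c b * gram N k a b)
      = (\<Sum>a\<in>A. \<Sum>b\<in>A. \<Sum>z\<in>F. (c a * feature N k a z) * (c b * feature N k b z))"
    by (simp add: sum_distrib_left mult_ac)
  also have "\<dots> = (\<Sum>z\<in>F. \<Sum>a\<in>A. \<Sum>b\<in>A. (c a * feature N k a z) * (c b * feature N k b z))"
  proof -
    have "(\<Sum>a\<in>A. \<Sum>b\<in>A. \<Sum>z\<in>F. (c a * feature N k a z) * (c b * feature N k b z))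
        = (\<Sum>a\<in>A. \<Sum>z\<in>F. \<Sum>b\<in>A. (c a * feature N k a z) * (c b * feature N k b z))"
      by (intro sum.cong refl sum.swap)
    also have "\<dots> = (\<Sum>z\<in>F. \<Sum>a\<in>A. \<Sum>b\<in>A. (c a * feature N k a z) * (c b * feature N k b z))"
      by (rule sum.swap)
    finally show ?thesis .
  qed
  also have "\<dots> = (\<Sum>z\<in>F. (\<Sum>a\<in>A. c a * feature N k a z)\<^sup>2)"
    by (simp add: power2_eq_square sum_product)
  also have "\<dots> \<ge> 0" by (intro sum_nonneg) simp
  finally show ?thesis .
qed

lemma root_kernel_square_sum:
  assumes F: "finite F"
    and reps: "\<And>y. (\<And>i. \<bar>y $ i - x $ i\<bar> \<le> int k) \<Longrightarrow> \<exists>!z. z \<in> F \<and> proj N z = proj N y"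
  shows "(\<Sum>z\<in>F. root_kernel N k (x - z) * root_kernel N k (w - z)) = green_term N k (x - w)"
    and "(\<Sum>z\<in>F. root_kernel N k (x - z)) = root_mass k"
proof -
  have ck: "(\<Sum>z\<in>F. ret N m (x - z) * ret N n (w - z)) = ret N (m + n) (x - w)"
    "(\<Sum>z\<in>F. ret N m (x - z)) = 1" if "m \<le> k" for m n
  proof -
    have reps': "\<exists>!z. z \<in> F \<and> proj N z = proj N y" if y: "\<And>i. \<bar>y $ i - x $ i\<bar> \<le> int m" for y
      by (rule reps, rule order_trans[OF y]) (use \<open>m \<le> k\<close> in simp)
    show "(\<Sum>z\<in>F. ret N m (x - z) * ret N n (w - z)) = ret N (m + n) (x - w)"
      unfolding ret_commute[of N n w] by (rule chapman_kolmogorov(1)[OF F reps'])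
    show "(\<Sum>z\<in>F. ret N m (x - z)) = 1"
      by (rule chapman_kolmogorov(2)[OF F reps'])
  qed
  show "(\<Sum>z\<in>F. root_kernel N k (x - z) * root_kernel N k (w - z)) = green_term N k (x - w)"
  proof (cases k)
    case 0
    then show ?thesis using ck(1)[of 0 0] by simp
  next
    case (Suc j)
    have ck': "(\<Sum>z\<in>F. ret N j (x - z) * ret N j (w - z)) = ret N (2 * j) (x - w)"
      "(\<Sum>z\<in>F. ret N j (x - z) * ret N (Suc j) (w - z)) = ret N (2 * j + 1) (x - w)"
      "(\<Sum>z\<in>F. ret N (Suc j) (x - z) * ret N j (w - z)) = ret N (2 * j + 1) (x - w)"
      "(\<Sum>z\<in>F. ret N (Suc j) (x - z) * ret N (Suc j) (w - z)) = ret N (2 * j + 2) (x - w)"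
      using ck(1)[of j j] ck(1)[of j "Suc j"] ck(1)[of "Suc j" j] ck(1)[of "Suc j" "Suc j"] Suc
      by (simp_all add: mult_2)
    show ?thesis
      unfolding Suc root_kernel.simps green_term.simps slice_def distrib_left distrib_right sum.distrib ck'
      by simp
  qed
  show "(\<Sum>z\<in>F. root_kernel N k (x - z)) = root_mass k"
    by (cases k) (simp_all add: ck sum.distrib)
qed

lemma gram_lattice: "gram N k (Inr x) (Inr y) = green_term 0 k (x - y)"
proof -
  let ?F = "{z. \<forall>i. \<bar>x $ i - z $ i\<bar> \<le> int k}"
  have "gram N k (Inr x) (Inr y) = (\<Sum>z\<in>?F. root_kernel 0 k (x - z) * root_kernel 0 k (y - z))"
  proof (subst gram_superset[OF finite_sup_ball])
    show "z \<in> ?F" if "feature N k (Inr x) z \<noteq> 0" for z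
      using that root_kernel_lattice_support[of k "x - z"] by simp
  qed simp
  also have "\<dots> = green_term 0 k (x - y)"
    by (rule root_kernel_square_sum(1)[OF finite_sup_ball]) (auto simp: abs_minus_commute)
  finally show ?thesis .
qed

text \<open>
  Subtracting its average from the torus kernel subtracts a multiple of the projection to constants
  from its square; the cross terms are constant because every row has the same sum.
\<close>

lemma gram_torus:
  fixes u w :: "int ^ 'd"
  assumes N: "N \<ge> 1"
  shows "gram N k (Inl u) (Inl w) = green_term N k (u - w) - (root_mass k)\<^sup>2 / real N ^ CARD('d)"
proof -
  let ?C = "centred_box N :: (int ^ 'd) set"
  define c where "c = root_mass k / real N ^ CARD('d)"
  have reps: "\<exists>!z. z \<in> ?C \<and> proj N z = proj N y" for y
    by (rule centred_box_transversal[OF N])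
  note sums = root_kernel_square_sum[OF finite_centred_box reps, where k=k]
  have "gram N k (Inl u) (Inl w) = (\<Sum>z\<in>?C. (root_kernel N k (u - z) - c) * (root_kernel N k (w - z) - c))"
    by (subst gram_superset[OF finite_centred_box]) (auto simp: c_def split: if_splits)
  also have "\<dots> = (\<Sum>z\<in>?C. root_kernel N k (u - z) * root_kernel N k (w - z))
      - c * (\<Sum>z\<in>?C. root_kernel N k (u - z)) - c * (\<Sum>z\<in>?C. root_kernel N k (w - z)) + c * c * card ?C"
    by (simp add: algebra_simps sum.distrib sum_subtractf sum_distrib_left sum_distrib_right)
  also have "\<dots> = green_term N k (u - w) - (root_mass k)\<^sup>2 / real N ^ CARD('d)"
    using N by (simp add: sums card_centred_box c_def power2_eq_square)
  finally show ?thesis .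
qed

subsection \<open>The coupled covariance\<close>

definition term_const :: "nat \<Rightarrow> real" where
  "term_const d = 4 * (heat_const d + 4)"

lemma term_const_pos: "0 < term_const d"
  using heat_const_pos[of d] by (simp add: term_const_def)

lemma gram_diag_bound:
  fixes a :: "int ^ 'd + int ^ 'd"
  assumes d: "CARD('d) \<ge> 3" and N: "N \<ge> 1" and k: "k \<ge> 1"
  shows "gram N k a a \<le> term_const CARD('d) * k powr (- (5/4))"
proof -
  obtain j where j: "k = Suc j" using k by (cases k) auto
  define M where "M = (case a of Inl _ \<Rightarrow> N | Inr _ \<Rightarrow> 0)"
  have g: "gram N k a a \<le> slice M j (0 :: int ^ 'd)"
    by (cases a) (simp_all add: M_def gram_torus[OF N] gram_lattice j)
  have g': "gram N k a a \<le> (heat_const CARD('d) + 4) * j powr (- (5/4))" if "j \<ge> 1"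
  proof (cases a)
    case (Inl u)
    then have "gram N k a a \<le> heat_const CARD('d) * j powr (- (5/4))"
      using slice_torus_bound[OF d N that, of 0] by (simp add: gram_torus[OF N] j)
    also have "\<dots> \<le> (heat_const CARD('d) + 4) * j powr (- (5/4))"
      by (intro mult_right_mono) auto
    finally show ?thesis .
  next
    case (Inr x)
    then show ?thesis using slice_lattice_bound[OF d that, of 0] by (simp add: gram_lattice j)
  qed
  show ?thesis
  proof (cases "j = 0")
    case True
    have "slice M 0 (0 :: int ^ 'd) \<le> 4"
      unfolding slice_def
      using ret_le_1[of M "2 * 0" "0 :: int ^ 'd"] ret_le_1[of M "2 * 0 + 1" "0 :: int ^ 'd"]
        ret_le_1[of M "2 * 0 + 2" "0 :: int ^ 'd"] by linarith
    then show ?thesis using g True heat_const_pos[of "CARD('d)"] by (simp add: j term_const_def)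
  next
    case False
    then have "real j powr (- (5/4)) \<le> (real k / 2) powr (- (5/4))"
      by (intro powr_mono2') (auto simp: j)
    also have "\<dots> = real k powr (- (5/4)) * 2 powr (5/4)"
      by (simp add: powr_divide powr_minus_divide)
    also have "\<dots> \<le> real k powr (- (5/4)) * 2 powr 2"
      by (intro mult_left_mono powr_mono) auto
    finally have "(heat_const CARD('d) + 4) * j powr (- (5/4)) \<le> (heat_const CARD('d) + 4) * (k powr (- (5/4)) * 4)"
      using heat_const_pos[of "CARD('d)"] by (intro mult_left_mono) (auto simp: powr_numeral)
    then show ?thesis using g' False by (simp add: term_const_def algebra_simps)
  qed
qed

definition feature_dist :: "nat \<Rightarrow> nat \<Rightarrow> int ^ 'd + int ^ 'd \<Rightarrow> int ^ 'd + int ^ 'd \<Rightarrow> real" where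
  "feature_dist N k a b = gram N k a a - 2 * gram N k a b + gram N k b b"

lemma feature_dist_superset:
  assumes F: "finite F" "\<And>z. feature N k a z \<noteq> 0 \<Longrightarrow> z \<in> F" "\<And>z. feature N k b z \<noteq> 0 \<Longrightarrow> z \<in> F"
  shows "feature_dist N k a b = (\<Sum>z\<in>F. (feature N k a z - feature N k b z)\<^sup>2)"
proof -
  have "gram N k x y = (\<Sum>z\<in>F. feature N k x z * feature N k y z)" if "x \<in> {a, b}" for x y
    using that F by (intro gram_superset) auto
  then show ?thesis
    by (simp add: feature_dist_def power2_eq_square algebra_simps sum.distrib sum_subtractf sum_distrib_left)
qed

text \<open>
  The inequality of arithmetic and geometric means for the inner product of two feature vectors.
\<close>

lemma gram_abs_le: "2 * \<bar>gram N k a b\<bar> \<le> gram N k a a + gram N k b b"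
proof -
  have "0 \<le> gram N k a a + 2 * s * gram N k a b + gram N k b b" if "s\<^sup>2 = 1" for s
  proof -
    have psd: "psd_kernel (gram N k)"
      unfolding psd_kernel_def by (blast intro: gram_sym gram_form_nonneg)
    show ?thesis
      using psd_kernel_form_add_point[OF psd, of "{a}" "\<lambda>_. 1" s b] that by simp
  qed
  from this[of 1] this[of "-1"] show ?thesis by simp
qed

lemma feature_dist_le: "feature_dist N k a b \<le> 2 * (gram N k a a + gram N k b b)"
  using gram_abs_le[of N k a b] by (simp add: feature_dist_def)

lemma summable_gram:
  fixes a b :: "int ^ 'd + int ^ 'd"
  assumes d: "CARD('d) \<ge> 3" and N: "N \<ge> 1"
  shows "summable (\<lambda>k. gram N k a b)"
proof (rule summable_comparison_test')
  show "summable (\<lambda>k. term_const CARD('d) * real k powr (- (5/4)))"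
    by (intro summable_mult summable_powr_5_4)
  show "norm (gram N k a b) \<le> term_const CARD('d) * real k powr (- (5/4))" if "1 \<le> k" for k
    using gram_abs_le[of N k a b] gram_diag_bound[OF d N that, of a] gram_diag_bound[OF d N that, of b] by simp
qed

definition joint_kernel :: "nat \<Rightarrow> int ^ 'd + int ^ 'd \<Rightarrow> int ^ 'd + int ^ 'd \<Rightarrow> real" where
  "joint_kernel N a b = 1/2 * (\<Sum>k. gram N k a b)"

lemma psd_joint_kernel:
  assumes d: "CARD('d) \<ge> 3" and N: "N \<ge> 1"
  shows "psd_kernel (joint_kernel N :: int ^ 'd + int ^ 'd \<Rightarrow> _)"
  unfolding psd_kernel_def
proof (intro conjI allI impI)
  show "joint_kernel N a b = joint_kernel N b a" for a b :: "int ^ 'd + int ^ 'd"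
    by (simp add: joint_kernel_def gram_sym[of N _ a b])
next
  fix A :: "(int ^ 'd + int ^ 'd) set" and c assume A: "finite A"
  note summ = summable_gram[OF d N]
  have "(\<lambda>k. \<Sum>a\<in>A. \<Sum>b\<in>A. c a * c b * gram N k a b) sums (\<Sum>a\<in>A. \<Sum>b\<in>A. c a * c b * (\<Sum>k. gram N k a b))"
    by (intro sums_sum sums_mult summable_sums summ)
  from sums_le[OF gram_form_nonneg[OF A] sums_zero this]
  have "0 \<le> (\<Sum>a\<in>A. \<Sum>b\<in>A. c a * c b * (\<Sum>k. gram N k a b))" .
  also have "\<dots> = 2 * (\<Sum>a\<in>A. \<Sum>b\<in>A. c a * c b * joint_kernel N a b)"
    by (simp add: joint_kernel_def sum_distrib_left)
  finally show "0 \<le> (\<Sum>a\<in>A. \<Sum>b\<in>A. c a * c b * joint_kernel N a b)" by simp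
qed

lemma joint_kernel_split_head:
  fixes a b :: "int ^ 'd + int ^ 'd"
  assumes "CARD('d) \<ge> 3" "N \<ge> 1"
  shows "joint_kernel N a b = 1/2 * gram N 0 a b + 1/2 * (\<Sum>k. gram N (Suc k) a b)"
  using suminf_split_head[OF summable_gram[OF assms, of a b]] by (simp add: joint_kernel_def field_simps)

lemma joint_kernel_torus:
  fixes u w :: "int ^ 'd"
  assumes d: "CARD('d) \<ge> 3" and N: "N \<ge> 1" and uw: "u \<in> torus N" "w \<in> torus N"
  shows "joint_kernel N (Inl u) (Inl w) = green_torus N u w"
  by (simp add: joint_kernel_split_head[OF d N] green_torus_eq[OF N uw] gram_torus[OF N])

lemma joint_kernel_lattice:
  fixes x y :: "int ^ 'd"
  assumes d: "CARD('d) \<ge> 3" and N: "N \<ge> 1"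
  shows "joint_kernel N (Inr x) (Inr y) = green_lattice x y"
  by (simp add: joint_kernel_split_head[OF d N] green_lattice_eq[OF d] gram_lattice)

subsection \<open>The two fields are close inside the box\<close>

lemma root_kernel_agree:
  assumes "\<And>i. \<bar>z $ i\<bar> + int k < int N"
  shows "root_kernel N k z = root_kernel 0 k z"
proof -
  have "ret N n z = ret 0 n z" if "n \<le> k" for n
  proof (rule ret_agree_short_time)
    show "\<bar>z $ i\<bar> + int n < int N" for i using assms[of i] that by simp
  qed
  then show ?thesis by (cases k) auto
qed

lemma root_kernel_cong_proj: "proj N z = proj N w \<Longrightarrow> root_kernel N k z = root_kernel N k w"
  by (cases k) (simp_all add: ret_cong_proj[of N z w])

text \<open>
  Until the walk from \<open>x\<close> can leave the representatives \<open>centred_box N\<close>, it cannot tell the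
  torus from the lattice, and the feature vectors differ only by the subtracted average.
\<close>

lemma feature_dist_short_time:
  fixes x :: "int ^ 'd"
  assumes N: "N \<ge> 1" and x: "x \<in> box_lattice N \<delta>" and k: "real k \<le> real N powr \<delta> / 2"
  shows "feature_dist N k (Inl (proj N x)) (Inr x) \<le> 4 / real N ^ CARD('d)"
proof -
  let ?C = "centred_box N :: (int ^ 'd) set" and ?V = "real N ^ CARD('d)"
  have xi: "2 * \<bar>real_of_int (x $ i)\<bar> \<le> real N - real N powr \<delta> - 2" for i
  proof -
    have lo: "- ((real N - real N powr \<delta> - 2) / 2) < real_of_int (x $ i)"
      and hi: "real_of_int (x $ i) \<le> (real N - real N powr \<delta> - 2) / 2"
      using x by (simp_all add: box_lattice_def)
    have "\<bar>real_of_int (x $ i)\<bar> \<le> (real N - real N powr \<delta> - 2) / 2"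
      using hi lo[THEN less_imp_le] by (intro abs_leI) (simp_all only: minus_le_iff[of "real_of_int (x $ i)"])
    then show ?thesis by simp
  qed
  have inside: "\<bar>(x - z) $ i\<bar> + int k < int N" if "z \<in> ?C" for z i
  proof -
    have "- int N < 2 * z $ i" "2 * z $ i \<le> int N" using that by (auto simp: centred_box_def)
    then have "2 * \<bar>z $ i\<bar> \<le> int N" by linarith
    then have "2 * \<bar>real_of_int (z $ i)\<bar> \<le> real N" by linarith
    moreover have "a + b + l < n" if "2 * a \<le> n - p - 2" "l \<le> p / 2" "2 * b \<le> n" for a b l n p :: real
      using that by linarith
    ultimately have "\<bar>real_of_int (x $ i)\<bar> + \<bar>real_of_int (z $ i)\<bar> + real k < real N"
      using xi[of i] k by blast
    then show ?thesis by simp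
  qed
  have outside: "z \<in> ?C" if nz: "root_kernel 0 k (x - z) \<noteq> 0" for z
  proof -
    have "\<bar>x $ i - z $ i\<bar> \<le> int k" for i
      using root_kernel_lattice_support[OF nz, of i] by simp
    then have "\<bar>real_of_int (x $ i) - real_of_int (z $ i)\<bar> \<le> real k" for i
      by (metis of_int_abs of_int_diff of_int_le_iff of_int_of_nat_eq)
    moreover have "2 * \<bar>b\<bar> < n" if "\<bar>a - b\<bar> \<le> l" "2 * \<bar>a\<bar> \<le> n - p - 2" "l \<le> p / 2" for a b l n p :: real
      using that by linarith
    ultimately have "2 * \<bar>real_of_int (z $ i)\<bar> < real N" for i
      using xi[of i] k by blast
    then have "real_of_int (2 * \<bar>z $ i\<bar>) < real_of_int (int N)" for i by simp
    then have "2 * \<bar>z $ i\<bar> < int N" for i by (simp only: of_int_less_iff)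
    moreover have "- n < 2 * j \<and> 2 * j \<le> n" if "2 * \<bar>j\<bar> < n" for j n :: int
      using that by linarith
    ultimately show ?thesis by (simp add: centred_box_def)
  qed
  have "feature_dist N k (Inl (proj N x)) (Inr x)
      = (\<Sum>z\<in>?C. (feature N k (Inl (proj N x)) z - feature N k (Inr x) z)\<^sup>2)"
    using outside by (intro feature_dist_superset) (auto split: if_splits)
  also have "\<dots> = (\<Sum>z\<in>?C. (root_mass k / ?V)\<^sup>2)"
  proof (intro sum.cong refl)
    fix z assume z: "z \<in> ?C"
    have "proj N (proj N x - z) = proj N (x - z)"
      using proj_eq_shift[of N "proj N x" x "- z"] by simp
    then have "root_kernel N k (proj N x - z) = root_kernel N k (x - z)"
      by (rule root_kernel_cong_proj)
    also have "\<dots> = root_kernel 0 k (x - z)"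
      by (rule root_kernel_agree) (rule inside[OF z])
    finally show "(feature N k (Inl (proj N x)) z - feature N k (Inr x) z)\<^sup>2 = (root_mass k / ?V)\<^sup>2"
      using z by (simp add: power2_eq_square)
  qed
  also have "\<dots> = (root_mass k)\<^sup>2 / ?V"
    using N by (simp add: card_centred_box power2_eq_square)
  also have "\<dots> \<le> 4 / ?V"
    by (intro divide_right_mono) (cases k; simp)+
  finally show ?thesis .
qed

definition variance_const :: "nat \<Rightarrow> real" where
  "variance_const d = 4 + 4 * term_const d * (\<Sum>k. real k powr (- (9/8)))"

lemma summable_powr_9_8: "summable (\<lambda>k. real k powr (- (9/8)))"
  by (subst summable_real_powr_iff) simp

lemma variance_const_pos: "0 < variance_const d"
  using term_const_pos[of d] suminf_nonneg[OF summable_powr_9_8]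
  by (simp add: variance_const_def add_pos_nonneg)

text \<open>
  The summands with \<open>k < T\<close> are short-time terms; there are at most \<open>2 * N\<close> of them. For the others, a
  factor \<open>k powr (- (1/8))\<close> is split off and bounded at \<open>k = T\<close>, which leaves a convergent series.
\<close>

theorem coupled_variance_bound:
  fixes x :: "int ^ 'd"
  assumes d: "CARD('d) \<ge> 3" and N: "N \<ge> 1" and \<delta>: "0 < \<delta>" "\<delta> < 1" and x: "x \<in> box_lattice N \<delta>"
  shows "joint_kernel N (Inl (proj N x)) (Inl (proj N x)) - 2 * joint_kernel N (Inl (proj N x)) (Inr x)
    + joint_kernel N (Inr x) (Inr x) \<le> variance_const CARD('d) * real N powr (- (\<delta> / 8))"
proof -
  let ?a = "Inl (proj N x) :: int ^ 'd + int ^ 'd" and ?b = "Inr x :: int ^ 'd + int ^ 'd"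
  let ?V = "real N ^ CARD('d)" and ?c = "term_const CARD('d)"
  define T where "T = nat \<lceil>real N powr \<delta> / 2\<rceil>"
  have Npos: "0 < real N powr \<delta>" using N by simp
  have T: "real N powr \<delta> / 2 \<le> real T" "real T \<le> real N powr \<delta> / 2 + 1"
    unfolding T_def using Npos by linarith+
  have T1: "1 \<le> T" using T(1) Npos by (cases T) auto
  have "real N powr \<delta> \<le> real N powr 1" using N \<delta> by (intro powr_mono) auto
  then have TN: "real T \<le> 2 * real N" using T(2) N by simp
  define g where "g k = (if k < T then 4 / ?V else 0) + 4 * ?c * T powr (- (1/8)) * k powr (- (9/8))" for k
  have le: "feature_dist N k ?a ?b \<le> g k" for k
  proof (cases "k < T")
    case True
    then have "real k \<le> real N powr \<delta> / 2" unfolding T_def by linarith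
    then have "feature_dist N k ?a ?b \<le> 4 / ?V" by (rule feature_dist_short_time[OF N x])
    also have "\<dots> \<le> g k"
      using True term_const_pos[of "CARD('d)"] by (simp add: g_def)
    finally show ?thesis .
  next
    case False
    then have k: "T \<le> k" "1 \<le> k" using T1 by auto
    have "feature_dist N k ?a ?b \<le> 4 * ?c * k powr (- (5/4))"
      using feature_dist_le[of N k ?a ?b] gram_diag_bound[OF d N k(2), of ?a] gram_diag_bound[OF d N k(2), of ?b]
      by simp
    also have "real k powr (- (5/4)) = k powr (- (1/8)) * k powr (- (9/8))"
      by (simp add: powr_add[symmetric])
    also have "4 * ?c * \<dots> \<le> 4 * ?c * (T powr (- (1/8)) * k powr (- (9/8)))"
      using k T1 term_const_pos[of "CARD('d)"] by (intro mult_left_mono mult_right_mono powr_mono2') auto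
    also have "\<dots> = g k" using False by (simp add: g_def)
    finally show ?thesis .
  qed
  have "g sums (T * (4 / ?V) + 4 * ?c * T powr (- (1/8)) * (\<Sum>k. real k powr (- (9/8))))"
    unfolding g_def
  proof (intro sums_add sums_mult summable_sums summable_powr_9_8)
    show "(\<lambda>k. if k < T then 4 / ?V else 0) sums (T * (4 / ?V))"
      using sums_If_finite_set[of "{..<T}" "\<lambda>_. 4 / ?V"] by simp
  qed
  moreover have "(\<lambda>k. feature_dist N k ?a ?b) sums ((\<Sum>k. gram N k ?a ?a) - 2 * (\<Sum>k. gram N k ?a ?b) + (\<Sum>k. gram N k ?b ?b))"
    unfolding feature_dist_def by (intro sums_add sums_diff sums_mult summable_sums summable_gram[OF d N])
  ultimately have "(\<Sum>k. gram N k ?a ?a) - 2 * (\<Sum>k. gram N k ?a ?b) + (\<Sum>k. gram N k ?b ?b)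
      \<le> T * (4 / ?V) + 4 * ?c * T powr (- (1/8)) * (\<Sum>k. real k powr (- (9/8)))"
    by (intro sums_le[OF le])
  also have "T * (4 / ?V) \<le> 8 * real N powr (- (\<delta> / 8))"
  proof -
    have "T * (4 / ?V) \<le> 2 * real N * (4 / ?V)" by (intro mult_right_mono TN) simp
    also have "\<dots> = 8 * (real N / ?V)" by simp
    also have "real N / ?V \<le> real N powr (- (\<delta> / 8))"
    proof -
      have "real N / ?V = real N powr (1 - real CARD('d))"
        using N by (simp add: powr_diff powr_realpow)
      also have "\<dots> \<le> real N powr (- (\<delta> / 8))"
        using N d \<delta> by (intro powr_mono) auto
      finally show ?thesis .
    qed
    finally show ?thesis by simp
  qed
  also have "4 * ?c * T powr (- (1/8)) * (\<Sum>k. real k powr (- (9/8)))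
      \<le> 4 * ?c * (2 * real N powr (- (\<delta> / 8))) * (\<Sum>k. real k powr (- (9/8)))"
  proof (intro mult_right_mono mult_left_mono)
    have "real T powr (- (1/8)) \<le> (real N powr \<delta> / 2) powr (- (1/8))"
      using T(1) Npos by (intro powr_mono2') auto
    also have "\<dots> = real N powr (- (\<delta> / 8)) * 2 powr (1/8)"
      by (simp add: powr_divide powr_powr powr_minus_divide)
    also have "\<dots> \<le> real N powr (- (\<delta> / 8)) * 2 powr 1"
      by (intro mult_left_mono powr_mono) auto
    finally show "real T powr (- (1/8)) \<le> 2 * real N powr (- (\<delta> / 8))" by simp
  qed (use term_const_pos[of "CARD('d)"] in \<open>auto intro: suminf_nonneg summable_powr_9_8\<close>)
  finally have "(\<Sum>k. gram N k ?a ?a) - 2 * (\<Sum>k. gram N k ?a ?b) + (\<Sum>k. gram N k ?b ?b)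
      \<le> 2 * (variance_const CARD('d) * real N powr (- (\<delta> / 8)))"
    by (simp add: variance_const_def algebra_simps)
  then show ?thesis by (simp add: joint_kernel_def)
qed

section \<open>The coupling\<close>

text \<open>
  If \<open>x\<close> is beyond \<open>\<epsilon>\<close>, then \<open>\<epsilon>\<^sup>2 + (x - \<epsilon>)\<^sup>2 \<le> x\<^sup>2\<close>, so there the density is at most a small multiple of
  its translate by \<open>\<epsilon>\<close>, which has total mass \<open>1\<close>.
\<close>

lemma gaussian_tail:
  assumes M: "prob_space M" and Z [measurable]: "Z \<in> borel_measurable M"
    and law: "gaussian_law (distr M borel Z)"
    and mean: "(\<integral>\<omega>. Z \<omega> \<partial>M) = 0" and var: "(\<integral>\<omega>. (Z \<omega>)\<^sup>2 \<partial>M) \<le> v" and \<epsilon>: "0 < \<epsilon>"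
  shows "measure M {\<omega> \<in> space M. \<epsilon> < \<bar>Z \<omega>\<bar>} \<le> 2 * exp (- (\<epsilon>\<^sup>2 / (2 * v)))"
proof -
  interpret prob_space M by (rule M)
  let ?A = "{x :: real. \<epsilon> < \<bar>x\<bar>}"
  have A: "measure M {\<omega> \<in> space M. \<epsilon> < \<bar>Z \<omega>\<bar>} = measure (distr M borel Z) ?A"
    by (subst measure_distr) (auto simp: vimage_def Int_def conj_commute)
  from law consider m where "distr M borel Z = return borel m"
    | m \<sigma> where "0 < \<sigma>" "distr M borel Z = density lborel (normal_density m \<sigma>)"
    by (auto simp: gaussian_law_def)
  then show ?thesis
  proof cases
    case 1
    have "(\<integral>\<omega>. Z \<omega> \<partial>M) = (\<integral>x. x \<partial>distr M borel Z)"
      by (rule integral_distr[symmetric]) auto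
    then have "m = 0" using mean 1 by (simp add: integral_return)
    then show ?thesis using \<epsilon> by (simp add: A 1 measure_return)
  next
    case 2
    have "distr M lborel Z = density lborel (normal_density m \<sigma>)"
      using 2 by (metis distr_cong sets_lborel)
    then have D: "distributed M lborel Z (normal_density m \<sigma>)"
      by (simp add: distributed_def)
    have m: "m = 0"
      using normal_distributed_expectation[OF 2(1) D] mean by simp
    have \<sigma>: "\<sigma>\<^sup>2 \<le> v"
      using normal_distributed_variance[OF 2(1) D] mean var by simp
    let ?e = "exp (- (\<epsilon>\<^sup>2 / (2 * \<sigma>\<^sup>2)))"
    have shift: "normal_density 0 \<sigma> x \<le> ?e * normal_density s \<sigma> x"
      if "s\<^sup>2 = \<epsilon>\<^sup>2" "\<epsilon>\<^sup>2 \<le> x * s" for s x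
    proof -
      have "\<epsilon>\<^sup>2 + (x - s)\<^sup>2 \<le> x\<^sup>2"
        using that by (simp add: power2_eq_square algebra_simps)
      then have "(\<epsilon>\<^sup>2 + (x - s)\<^sup>2) / (2 * \<sigma>\<^sup>2) \<le> x\<^sup>2 / (2 * \<sigma>\<^sup>2)"
        by (rule divide_right_mono) simp
      then have "exp (- (x\<^sup>2 / (2 * \<sigma>\<^sup>2))) \<le> ?e * exp (- ((x - s)\<^sup>2 / (2 * \<sigma>\<^sup>2)))"
        by (simp add: exp_add[symmetric] add_divide_distrib)
      then show ?thesis
        by (simp add: normal_density_def divide_right_mono)
    qed
    have le: "indicator ?A x * normal_density 0 \<sigma> x \<le> ?e * (normal_density \<epsilon> \<sigma> x + normal_density (- \<epsilon>) \<sigma> x)" for x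
    proof (cases "\<epsilon> < \<bar>x\<bar>")
      case True
      then consider "\<epsilon> < x" | "x < - \<epsilon>" by linarith
      then show ?thesis
      proof cases
        case 1
        then have "normal_density 0 \<sigma> x \<le> ?e * normal_density \<epsilon> \<sigma> x"
          using \<epsilon> by (intro shift) (auto simp: power2_eq_square)
        moreover have "0 \<le> ?e * normal_density (- \<epsilon>) \<sigma> x" by simp
        ultimately have "normal_density 0 \<sigma> x \<le> ?e * normal_density \<epsilon> \<sigma> x + ?e * normal_density (- \<epsilon>) \<sigma> x"
          by (rule order_trans[OF _ add_increasing2[rotated, OF order_refl]])
        then show ?thesis using True by (simp add: distrib_left)
      next
        case 2
        then have "\<epsilon> * \<epsilon> \<le> (- x) * \<epsilon>" using \<epsilon> by (intro mult_right_mono) auto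
        then have "normal_density 0 \<sigma> x \<le> ?e * normal_density (- \<epsilon>) \<sigma> x"
          by (intro shift) (auto simp: power2_eq_square)
        moreover have "0 \<le> ?e * normal_density \<epsilon> \<sigma> x" by simp
        ultimately have "normal_density 0 \<sigma> x \<le> ?e * normal_density \<epsilon> \<sigma> x + ?e * normal_density (- \<epsilon>) \<sigma> x"
          by (rule order_trans[OF _ add_increasing[OF _ order_refl]])
        then show ?thesis using True by (simp add: distrib_left)
      qed
    qed simp
    have "measure (distr M borel Z) ?A = (\<integral>x. indicator ?A x \<partial>density lborel (normal_density m \<sigma>))"
      unfolding 2 by (simp add: measure_def)
    also have "\<dots> = (\<integral>x. indicator ?A x * normal_density 0 \<sigma> x \<partial>lborel)"
      by (subst integral_density) (auto simp: m mult.commute)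
    also have "\<dots> \<le> (\<integral>x. ?e * (normal_density \<epsilon> \<sigma> x + normal_density (- \<epsilon>) \<sigma> x) \<partial>lborel)"
    proof (rule integral_mono)
      show "integrable lborel (\<lambda>x. indicator ?A x * normal_density 0 \<sigma> x)"
        by (rule Bochner_Integration.integrable_bound[OF integrable_normal_density[OF 2(1), of 0]])
           (auto simp: indicator_def)
    qed (use 2 le in auto)
    also have "\<dots> = 2 * ?e" using 2 by simp
    also have "?e \<le> exp (- (\<epsilon>\<^sup>2 / (2 * v)))"
      using 2(1) \<sigma> \<epsilon> by (simp add: frac_le zero_less_power)
    finally show ?thesis by (simp add: A)
  qed
qed

lemma gaussian_law_square_integrable:
  assumes M: "prob_space M" and Z [measurable]: "Z \<in> borel_measurable M"
    and law: "gaussian_law (distr M borel Z)"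
  shows "integrable M (\<lambda>\<omega>. (Z \<omega>)\<^sup>2)"
proof -
  interpret prob_space M by (rule M)
  have "integrable (distr M borel Z) (\<lambda>x. x\<^sup>2)"
  proof -
    from law consider m where "distr M borel Z = return borel m"
      | m \<sigma> where "0 < \<sigma>" "distr M borel Z = density lborel (normal_density m \<sigma>)"
      by (auto simp: gaussian_law_def)
    then show ?thesis
    proof cases
      case 1
      have "integrable (return borel m) (\<lambda>x :: real. x\<^sup>2)"
        by (rule integrableI_bounded) (auto simp: nn_integral_return)
      then show ?thesis by (simp add: 1)
    next
      case 2
      have "integrable lborel (\<lambda>x. normal_density m \<sigma> x * (x - m) ^ 2 + 2 * m * (normal_density m \<sigma> x * (x - m) ^ 1)
          + m\<^sup>2 * (normal_density m \<sigma> x * (x - m) ^ 0))"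
        by (intro Bochner_Integration.integrable_add integrable_mult_right integrable_normal_moment 2(1))
      also have "(\<lambda>x. normal_density m \<sigma> x * (x - m) ^ 2 + 2 * m * (normal_density m \<sigma> x * (x - m) ^ 1)
          + m\<^sup>2 * (normal_density m \<sigma> x * (x - m) ^ 0)) = (\<lambda>x. normal_density m \<sigma> x *\<^sub>R x\<^sup>2)"
        by (simp add: fun_eq_iff power2_eq_square algebra_simps)
      finally show ?thesis
        unfolding 2 by (subst integrable_density) auto
    qed
  qed
  then show ?thesis by (subst (asm) integrable_distr_eq) auto
qed

lemma centered_gaussian_field_transfer:
  assumes X: "centered_gaussian_field M UNIV X K"
    and f [measurable]: "f \<in> M \<rightarrow>\<^sub>M Q0" and Y [measurable]: "\<And>i. i \<in> I \<Longrightarrow> Y i \<in> borel_measurable Q0"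
    and g: "inj_on g I"
    and Yf: "\<And>i \<omega>. i \<in> I \<Longrightarrow> Y i (f \<omega>) = X (g i) \<omega>"
    and K: "\<And>i j. i \<in> I \<Longrightarrow> j \<in> I \<Longrightarrow> K (g i) (g j) = K' i j"
  shows "centered_gaussian_field (distr M Q0 f) I Y K'"
proof -
  interpret prob_space M using X by (simp add: centered_gaussian_field_def)
  show ?thesis
    unfolding centered_gaussian_field_def
  proof (intro conjI ballI allI impI)
    show "prob_space (distr M Q0 f)" by (rule prob_space_distr) fact
    show "Y i \<in> borel_measurable (distr M Q0 f)" if "i \<in> I" for i using Y[OF that] by simp
  next
    fix A a assume A: "finite A \<and> A \<subseteq> I"
    have m: "(\<lambda>\<omega>. \<Sum>x\<in>A. a x * Y x \<omega>) \<in> borel_measurable Q0"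
      using A by (intro borel_measurable_sum borel_measurable_times borel_measurable_const Y) auto
    have inj: "inj_on g A" using g A inj_on_subset by blast
    have "distr (distr M Q0 f) borel (\<lambda>\<omega>. \<Sum>x\<in>A. a x * Y x \<omega>)
        = distr M borel (\<lambda>\<omega>. \<Sum>x\<in>A. a x * Y x (f \<omega>))"
      by (subst distr_distr[OF m f]) (simp add: comp_def)
    also have "(\<lambda>\<omega>. \<Sum>x\<in>A. a x * Y x (f \<omega>)) = (\<lambda>\<omega>. \<Sum>y\<in>g ` A. a (the_inv_into A g y) * X y \<omega>)"
      using A Yf by (auto simp: sum.reindex[OF inj] the_inv_into_f_f[OF inj] subset_iff intro!: sum.cong)
    also have "gaussian_law (distr M borel \<dots>)"
      using X A by (simp add: centered_gaussian_field_def)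
    finally show "gaussian_law (distr (distr M Q0 f) borel (\<lambda>\<omega>. \<Sum>x\<in>A. a x * Y x \<omega>))" .
  next
    show "(\<integral>\<omega>. Y i \<omega> \<partial>distr M Q0 f) = 0" if i: "i \<in> I" for i
      using X by (subst integral_distr[OF f Y[OF i]]) (simp add: Yf[OF i] centered_gaussian_field_def)
    show "(\<integral>\<omega>. Y i \<omega> * Y j \<omega> \<partial>distr M Q0 f) = K' i j" if i: "i \<in> I" and j: "j \<in> I" for i j
      using X by (subst integral_distr[OF f borel_measurable_times[OF Y[OF i] Y[OF j]]])
        (simp add: Yf[OF i] Yf[OF j] K[OF i j, symmetric] centered_gaussian_field_def)
  qed
qed

lemma gaussian_difference_tail:
  assumes X: "centered_gaussian_field M UNIV X K"
    and ab: "a \<noteq> b" and v: "K a a - 2 * K a b + K b b \<le> v" and \<epsilon>: "0 < \<epsilon>"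
  shows "measure M {\<omega> \<in> space M. \<epsilon> < \<bar>X a \<omega> - X b \<omega>\<bar>} \<le> 2 * exp (- (\<epsilon>\<^sup>2 / (2 * v)))"
proof -
  interpret prob_space M using X by (simp add: centered_gaussian_field_def)
  have meas [measurable]: "X c \<in> borel_measurable M" for c
    using X by (simp add: centered_gaussian_field_def)
  have mean: "expectation (X c) = 0" and cov: "expectation (\<lambda>\<omega>. X c \<omega> * X e \<omega>) = K c e" for c e
    using X by (simp_all add: centered_gaussian_field_def)
  have gauss: "\<forall>A a. finite A \<and> A \<subseteq> UNIV \<longrightarrow> gaussian_law (distr M borel (\<lambda>\<omega>. \<Sum>c\<in>A. a c * X c \<omega>))"
    using X by (simp add: centered_gaussian_field_def)
  have "gaussian_law (distr M borel (X c))" for c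
    using gauss[rule_format, of "{c}" "\<lambda>_. 1"] by simp
  then have sq: "integrable M (\<lambda>\<omega>. (X c \<omega>)\<^sup>2)" for c
    by (intro gaussian_law_square_integrable prob_space_axioms) simp_all
  have int: "integrable M (X c)" for c
    by (rule square_integrable_imp_integrable) (use sq in auto)
  have prod_le: "\<bar>p * q\<bar> \<le> \<bar>p\<^sup>2 + q\<^sup>2\<bar>" for p q :: real
  proof -
    have "2 * (\<bar>p\<bar> * \<bar>q\<bar>) \<le> p\<^sup>2 + q\<^sup>2" using sum_squares_bound[of "\<bar>p\<bar>" "\<bar>q\<bar>"] by (simp add: mult.assoc)
    moreover have "0 \<le> \<bar>p\<bar> * \<bar>q\<bar>" by simp
    ultimately show ?thesis unfolding abs_mult by linarith
  qed
  have int2: "integrable M (\<lambda>\<omega>. X c \<omega> * X e \<omega>)" for c e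
  proof (rule Bochner_Integration.integrable_bound[OF Bochner_Integration.integrable_add[OF sq[of c] sq[of e]]])
    show "AE \<omega> in M. norm (X c \<omega> * X e \<omega>) \<le> norm ((X c \<omega>)\<^sup>2 + (X e \<omega>)\<^sup>2)"
      unfolding real_norm_def by (intro AE_I2 prod_le)
  qed measurable
  define w where "w c = (if c = a then 1 else - 1 :: real)" for c
  have law: "gaussian_law (distr M borel (\<lambda>\<omega>. X a \<omega> - X b \<omega>))"
    using gauss[rule_format, of "{a, b}" w] ab by (simp add: w_def)
  have "expectation (\<lambda>\<omega>. (X a \<omega> - X b \<omega>)\<^sup>2)
      = expectation (\<lambda>\<omega>. X a \<omega> * X a \<omega> - 2 * (X a \<omega> * X b \<omega>) + X b \<omega> * X b \<omega>)"
    by (simp add: power2_eq_square algebra_simps)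
  also have "\<dots> = K a a - 2 * K a b + K b b"
    using int2 by (simp add: cov)
  finally have var: "expectation (\<lambda>\<omega>. (X a \<omega> - X b \<omega>)\<^sup>2) \<le> v" using v by simp
  show ?thesis
    by (rule gaussian_tail[OF _ _ law _ var \<epsilon>]) (use int in \<open>auto simp: mean prob_space_axioms\<close>)
qed

lemma GFF_coupling_exists:
  assumes d: "CARD('d::finite) \<ge> 3" and N: "N \<ge> 1"
  shows "\<exists>Q :: ((int ^ 'd \<Rightarrow> real) \<times> (int ^ 'd \<Rightarrow> real)) measure. GFF_coupling N Q \<and>
    (\<forall>\<delta>\<in>{0<..<1}. \<forall>x\<in>box_lattice N \<delta>. \<forall>\<epsilon>>0.
      measure Q {\<omega> \<in> space Q. \<epsilon> < \<bar>fst \<omega> (proj N x) - snd \<omega> x\<bar>}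
        \<le> 2 * exp (- (\<epsilon>\<^sup>2 / (2 * (variance_const CARD('d) * real N powr (- (\<delta> / 8)))))))"
proof -
  define K where "K = (joint_kernel N :: int ^ 'd + int ^ 'd \<Rightarrow> int ^ 'd + int ^ 'd \<Rightarrow> real)"
  have "psd_kernel K" unfolding K_def by (rule psd_joint_kernel[OF d N])
  then obtain X where X: "centered_gaussian_field white_noise UNIV X K"
    by (rule centered_gaussian_field_exists)
  have meas [measurable]: "X c \<in> borel_measurable white_noise" for c
    using X by (simp add: centered_gaussian_field_def)
  define Q0 where "Q0 = (\<Pi>\<^sub>M x\<in>(torus N :: (int ^ 'd) set). (borel :: real measure)) \<Otimes>\<^sub>M (\<Pi>\<^sub>M x\<in>(UNIV :: (int ^ 'd) set). (borel :: real measure))"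
  define f where "f \<omega> = ((\<lambda>u\<in>torus N. X (Inl u) \<omega>), (\<lambda>x. X (Inr x) \<omega>))" for \<omega>
  have f [measurable]: "f \<in> white_noise \<rightarrow>\<^sub>M Q0"
    unfolding f_def Q0_def
    by (intro measurable_Pair measurable_restrict measurable_PiM_single') (auto intro: meas)
  have fst_m [measurable]: "(\<lambda>\<omega>. fst \<omega> u) \<in> borel_measurable Q0" if "u \<in> torus N" for u
    unfolding Q0_def by (rule measurable_compose[OF measurable_fst measurable_component_singleton[OF that]])
  have snd_m [measurable]: "(\<lambda>\<omega>. snd \<omega> x) \<in> borel_measurable Q0" for x
    unfolding Q0_def by (rule measurable_compose[OF measurable_snd measurable_component_singleton]) simp
  let ?Q = "distr white_noise Q0 f"
  have "GFF_coupling N ?Q"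
    unfolding GFF_coupling_def
  proof (intro conjI)
    show "sets ?Q = sets ((\<Pi>\<^sub>M x\<in>torus N. borel) \<Otimes>\<^sub>M (\<Pi>\<^sub>M x\<in>UNIV. borel))"
      by (simp add: Q0_def)
    show "centered_gaussian_field ?Q (torus N) (\<lambda>x \<omega>. fst \<omega> x) (green_torus N)"
      by (rule centered_gaussian_field_transfer[OF X f fst_m, where g=Inl])
         (auto simp: f_def K_def joint_kernel_torus[OF d N])
    show "centered_gaussian_field ?Q UNIV (\<lambda>x \<omega>. snd \<omega> x) green_lattice"
      by (rule centered_gaussian_field_transfer[OF X f snd_m, where g=Inr])
         (auto simp: f_def K_def joint_kernel_lattice[OF d N])
  qed
  moreover have "measure ?Q {\<omega> \<in> space ?Q. \<epsilon> < \<bar>fst \<omega> (proj N x) - snd \<omega> x\<bar>}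
        \<le> 2 * exp (- (\<epsilon>\<^sup>2 / (2 * (variance_const CARD('d) * real N powr (- (\<delta> / 8))))))"
    if \<delta>: "\<delta> \<in> {0<..<1}" and x: "x \<in> box_lattice N \<delta>" and \<epsilon>: "\<epsilon> > 0" for \<delta> x \<epsilon>
  proof -
    have px: "proj N x \<in> torus N" by (rule proj_in_torus[OF N])
    note [measurable] = fst_m[OF px]
    have "measure ?Q {\<omega> \<in> space ?Q. \<epsilon> < \<bar>fst \<omega> (proj N x) - snd \<omega> x\<bar>}
        = measure white_noise (f -` {\<omega> \<in> space Q0. \<epsilon> < \<bar>fst \<omega> (proj N x) - snd \<omega> x\<bar>} \<inter> space white_noise)"
      by (subst measure_distr[OF f]) (simp_all, measurable)
    also have "f -` {\<omega> \<in> space Q0. \<epsilon> < \<bar>fst \<omega> (proj N x) - snd \<omega> x\<bar>} \<inter> space white_noise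
        = {\<omega> \<in> space white_noise. \<epsilon> < \<bar>X (Inl (proj N x)) \<omega> - X (Inr x) \<omega>\<bar>}"
      using measurable_space[OF f] px by (auto simp: f_def)
    also have "measure white_noise \<dots> \<le> 2 * exp (- (\<epsilon>\<^sup>2 / (2 * (variance_const CARD('d) * real N powr (- (\<delta> / 8))))))"
      using coupled_variance_bound[OF d N _ _ x] \<delta>
      by (intro gaussian_difference_tail[OF X _ _ \<epsilon>]) (auto simp: K_def)
    finally show ?thesis .
  qed
  ultimately show ?thesis by blast
qed

section \<open>Level sets\<close>

lemma box_lattice_subset_centred_box: "box_lattice N \<delta> \<subseteq> centred_box N"
proof
  fix x :: "int ^ 'd" assume x: "x \<in> box_lattice N \<delta>"
  have "- int N < 2 * x $ i \<and> 2 * x $ i \<le> int N" for i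
  proof -
    have lo: "- n < 2 * r" if "0 \<le> p" "- ((n - p - 2) / 2) < r" for n p r :: real
      using that by argo
    have hi: "2 * r \<le> n" if "0 \<le> p" "r \<le> (n - p - 2) / 2" for n p r :: real
      using that by argo
    have "- real N < 2 * real_of_int (x $ i)"
      by (rule lo[of "real N powr \<delta>"]) (use x in \<open>simp_all add: box_lattice_def\<close>)
    moreover have "2 * real_of_int (x $ i) \<le> real N"
      by (rule hi[of "real N powr \<delta>"]) (use x in \<open>simp_all add: box_lattice_def\<close>)
    ultimately have "real_of_int (- int N) < real_of_int (2 * x $ i)" "real_of_int (2 * x $ i) \<le> real_of_int (int N)"
      by simp_all
    then show ?thesis by (simp only: of_int_less_iff of_int_le_iff)
  qed
  then show "x \<in> centred_box N" by (simp add: centred_box_def)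
qed

lemma finite_box_lattice: "finite (box_lattice N \<delta>)"
  by (rule finite_subset[OF box_lattice_subset_centred_box finite_centred_box])

text \<open>
  Only the field values on the finite box enter, so that the event is measurable.
\<close>

lemma level_sets_sandwiched_iff:
  assumes "N \<ge> 1"
  shows "level_sets_sandwiched N \<delta> \<epsilon> h \<psi> \<phi> \<longleftrightarrow>
    (\<forall>x\<in>box_lattice N \<delta>. h + \<epsilon> \<le> \<phi> x \<longrightarrow> h \<le> \<psi> (proj N x)) \<and>
    (\<forall>x\<in>box_lattice N \<delta>. h \<le> \<psi> (proj N x) \<longrightarrow>
      (\<exists>y\<in>box_lattice N \<delta>. proj N y = proj N x \<and> h - \<epsilon> \<le> \<phi> y))"
proof -
  have "proj N ` (level_set_lattice \<phi> (h + \<epsilon>) \<inter> box_lattice N \<delta>) \<subseteq> level_set_torus N \<psi> h \<inter> box_torus N \<delta>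
      \<longleftrightarrow> (\<forall>x\<in>box_lattice N \<delta>. h + \<epsilon> \<le> \<phi> x \<longrightarrow> h \<le> \<psi> (proj N x))"
    using proj_in_torus[OF assms]
    by (auto simp: level_set_torus_def level_set_lattice_def box_torus_def)
  moreover have "level_set_torus N \<psi> h \<inter> box_torus N \<delta> \<subseteq> proj N ` (level_set_lattice \<phi> (h - \<epsilon>) \<inter> box_lattice N \<delta>)
      \<longleftrightarrow> (\<forall>x\<in>box_lattice N \<delta>. h \<le> \<psi> (proj N x) \<longrightarrow>
        (\<exists>y\<in>box_lattice N \<delta>. proj N y = proj N x \<and> h - \<epsilon> \<le> \<phi> y))"
  proof
    assume L: "level_set_torus N \<psi> h \<inter> box_torus N \<delta> \<subseteq> proj N ` (level_set_lattice \<phi> (h - \<epsilon>) \<inter> box_lattice N \<delta>)"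
    show "\<forall>x\<in>box_lattice N \<delta>. h \<le> \<psi> (proj N x) \<longrightarrow>
        (\<exists>y\<in>box_lattice N \<delta>. proj N y = proj N x \<and> h - \<epsilon> \<le> \<phi> y)"
    proof (intro ballI impI)
      fix x assume "x \<in> box_lattice N \<delta>" "h \<le> \<psi> (proj N x)"
      then have "proj N x \<in> level_set_torus N \<psi> h \<inter> box_torus N \<delta>"
        using proj_in_torus[OF assms] by (simp add: level_set_torus_def box_torus_def)
      with L obtain y where "proj N x = proj N y" "y \<in> level_set_lattice \<phi> (h - \<epsilon>)" "y \<in> box_lattice N \<delta>"
        by blast
      then show "\<exists>y\<in>box_lattice N \<delta>. proj N y = proj N x \<and> h - \<epsilon> \<le> \<phi> y"
        by (intro bexI[of _ y]) (simp_all add: level_set_lattice_def)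
    qed
  next
    assume R: "\<forall>x\<in>box_lattice N \<delta>. h \<le> \<psi> (proj N x) \<longrightarrow>
        (\<exists>y\<in>box_lattice N \<delta>. proj N y = proj N x \<and> h - \<epsilon> \<le> \<phi> y)"
    show "level_set_torus N \<psi> h \<inter> box_torus N \<delta> \<subseteq> proj N ` (level_set_lattice \<phi> (h - \<epsilon>) \<inter> box_lattice N \<delta>)"
    proof
      fix u assume u: "u \<in> level_set_torus N \<psi> h \<inter> box_torus N \<delta>"
      then obtain x where x: "x \<in> box_lattice N \<delta>" "u = proj N x" by (auto simp: box_torus_def)
      with u have "h \<le> \<psi> (proj N x)" by (simp add: level_set_torus_def)
      with R x obtain y where "y \<in> box_lattice N \<delta>" "proj N y = proj N x" "h - \<epsilon> \<le> \<phi> y" by blast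
      then show "u \<in> proj N ` (level_set_lattice \<phi> (h - \<epsilon>) \<inter> box_lattice N \<delta>)"
        unfolding x(2) by (intro image_eqI[of _ _ y]) (simp_all add: level_set_lattice_def)
    qed
  qed
  ultimately show ?thesis unfolding level_sets_sandwiched_def by blast
qed

lemma level_sets_sandwiched_if_close:
  fixes \<psi> \<phi> :: "int ^ 'd \<Rightarrow> real"
  assumes "N \<ge> 1" "\<And>x. x \<in> box_lattice N \<delta> \<Longrightarrow> \<bar>\<psi> (proj N x) - \<phi> x\<bar> \<le> \<epsilon>"
  shows "level_sets_sandwiched N \<delta> \<epsilon> h \<psi> \<phi>"
  unfolding level_sets_sandwiched_iff[OF assms(1)]
proof (intro conjI ballI impI)
  fix x :: "int ^ 'd" assume x: "x \<in> box_lattice N \<delta>"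
  note close = assms(2)[OF x]
  show "h \<le> \<psi> (proj N x)" if "h + \<epsilon> \<le> \<phi> x" using that close by linarith
  show "\<exists>y\<in>box_lattice N \<delta>. proj N y = proj N x \<and> h - \<epsilon> \<le> \<phi> y" if "h \<le> \<psi> (proj N x)"
    using that close x by (intro bexI[of _ x]) auto
qed

lemma level_sets_sandwiched_prob:
  fixes Q :: "((int ^ 'd \<Rightarrow> real) \<times> (int ^ 'd \<Rightarrow> real)) measure"
  assumes N: "N \<ge> 1" and Q: "GFF_coupling N Q"
    and "0 \<le> p" and close: "\<And>x. x \<in> box_lattice N \<delta> \<Longrightarrow>
      measure Q {\<omega> \<in> space Q. \<epsilon> < \<bar>fst \<omega> (proj N x) - snd \<omega> x\<bar>} \<le> p"
  shows "1 - real N ^ CARD('d) * p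
    \<le> measure Q {\<omega> \<in> space Q. level_sets_sandwiched N \<delta> \<epsilon> h (fst \<omega>) (snd \<omega>)}"
proof -
  interpret prob_space Q
    using Q by (simp add: GFF_coupling_def centered_gaussian_field_def)
  let ?B = "box_lattice N \<delta> :: (int ^ 'd) set"
  let ?S = "{\<omega> \<in> space Q. level_sets_sandwiched N \<delta> \<epsilon> h (fst \<omega>) (snd \<omega>)}"
  let ?D = "\<lambda>x. {\<omega> \<in> space Q. \<epsilon> < \<bar>fst \<omega> (proj N x) - snd \<omega> x\<bar>}"
  have [measurable]: "(\<lambda>\<omega>. fst \<omega> (proj N x)) \<in> borel_measurable Q" "(\<lambda>\<omega>. snd \<omega> x) \<in> borel_measurable Q" for x
    using Q proj_in_torus[OF N, of x] by (simp_all add: GFF_coupling_def centered_gaussian_field_def)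
  have D: "?D x \<in> events" for x by measurable
  have S: "?S \<in> events"
    unfolding level_sets_sandwiched_iff[OF N] by measurable
  have "card ?B \<le> card (centred_box N :: (int ^ 'd) set)"
    by (rule card_mono[OF finite_centred_box box_lattice_subset_centred_box])
  also have "\<dots> = N ^ CARD('d)" by (rule card_centred_box[OF N])
  finally have "card ?B \<le> N ^ CARD('d)" .
  then have card: "real (card ?B) \<le> real N ^ CARD('d)"
    by (metis of_nat_le_iff of_nat_power)
  have "space Q - ?S \<subseteq> (\<Union>x\<in>?B. ?D x)"
  proof (rule subsetI, rule ccontr)
    fix \<omega> assume \<omega>: "\<omega> \<in> space Q - ?S" "\<omega> \<notin> (\<Union>x\<in>?B. ?D x)"
    then have "\<bar>fst \<omega> (proj N x) - snd \<omega> x\<bar> \<le> \<epsilon>" if "x \<in> ?B" for x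
      using that by (auto simp: not_less)
    then have "level_sets_sandwiched N \<delta> \<epsilon> h (fst \<omega>) (snd \<omega>)"
      by (rule level_sets_sandwiched_if_close[OF N])
    with \<omega> show False by simp
  qed
  then have "prob (space Q - ?S) \<le> prob (\<Union>x\<in>?B. ?D x)"
    using D finite_box_lattice by (intro finite_measure_mono) auto
  also have "\<dots> \<le> (\<Sum>x\<in>?B. prob (?D x))"
    using D finite_box_lattice by (intro finite_measure_subadditive_finite) auto
  also have "\<dots> \<le> (\<Sum>x\<in>?B. p)" by (intro sum_mono close)
  also have "\<dots> \<le> real N ^ CARD('d) * p"
    using card \<open>0 \<le> p\<close> by (simp add: mult_right_mono)
  finally show ?thesis using prob_compl[OF S] by simp
qed

theorem corollary3p5:
  assumes "CARD('d::finite) \<ge> 3"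
  shows "\<exists>Q :: nat \<Rightarrow> ((int ^ 'd \<Rightarrow> real) \<times> (int ^ 'd \<Rightarrow> real)) measure.
    (\<forall>N\<ge>1. GFF_coupling N (Q N)) \<and>
    (\<forall>\<delta>\<in>{1/2<..<1}. \<exists>c>0. \<exists>c'>0. \<forall>\<epsilon>>0. \<forall>h. \<forall>N\<ge>1.
       measure (Q N) {\<omega> \<in> space (Q N). level_sets_sandwiched N \<delta> \<epsilon> h (fst \<omega>) (snd \<omega>)}
         \<ge> 1 - 4 * real N ^ CARD('d) * exp (- c * \<epsilon>\<^sup>2 * real N powr c')) \<and>
    (\<forall>\<delta>\<in>{1/2<..<1}. \<forall>\<epsilon>>0. \<forall>h.
       (\<lambda>N. measure (Q N) {\<omega> \<in> space (Q N). level_sets_sandwiched N \<delta> \<epsilon> h (fst \<omega>) (snd \<omega>)})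
         \<longlonglongrightarrow> 1)"
proof -
  define v where "v = variance_const CARD('d)"
  have v: "0 < v" by (simp add: v_def variance_const_pos)
  define P where "P N Q \<longleftrightarrow> GFF_coupling N Q \<and>
    (\<forall>\<delta>\<in>{0<..<1}. \<forall>x\<in>box_lattice N \<delta>. \<forall>\<epsilon>>0.
      measure Q {\<omega> \<in> space Q. \<epsilon> < \<bar>fst \<omega> (proj N x) - snd \<omega> x\<bar>}
        \<le> 2 * exp (- (\<epsilon>\<^sup>2 / (2 * (v * real N powr (- (\<delta> / 8)))))))"
    for N and Q :: "((int ^ 'd \<Rightarrow> real) \<times> (int ^ 'd \<Rightarrow> real)) measure"
  have "\<exists>Q. P N Q" if "N \<ge> 1" for N
    unfolding P_def v_def by (rule GFF_coupling_exists[OF assms that])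
  then obtain Q where PQ: "\<And>N. N \<ge> 1 \<Longrightarrow> P N (Q N)"
    by metis
  have Q: "GFF_coupling N (Q N)" if "N \<ge> 1" for N
    using PQ[OF that] unfolding P_def by (rule conjunct1)
  have close: "measure (Q N) {\<omega> \<in> space (Q N). \<epsilon> < \<bar>fst \<omega> (proj N x) - snd \<omega> x\<bar>}
          \<le> 2 * exp (- (\<epsilon>\<^sup>2 / (2 * (v * real N powr (- (\<delta> / 8))))))"
    if "N \<ge> 1" "\<delta> \<in> {0<..<1}" "x \<in> box_lattice N \<delta>" "0 < \<epsilon>" for N \<delta> x \<epsilon>
    using PQ[OF that(1), unfolded P_def, THEN conjunct2] that(2-4) by simp
  define S where "S N \<delta> \<epsilon> h = {\<omega> \<in> space (Q N). level_sets_sandwiched N \<delta> \<epsilon> h (fst \<omega>) (snd \<omega>)}" for N \<delta> \<epsilon> h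
  have bound: "1 - 4 * real N ^ CARD('d) * exp (- (1 / (2 * v)) * \<epsilon>\<^sup>2 * real N powr (\<delta> / 8)) \<le> measure (Q N) (S N \<delta> \<epsilon> h)"
    if N: "N \<ge> 1" and \<delta>: "\<delta> \<in> {1/2<..<1}" and \<epsilon>: "\<epsilon> > 0" for N \<delta> \<epsilon> h
  proof -
    let ?e = "exp (- (1 / (2 * v)) * \<epsilon>\<^sup>2 * real N powr (\<delta> / 8))"
    have "\<epsilon>\<^sup>2 / (2 * (v * real N powr (- (\<delta> / 8)))) = (1 / (2 * v)) * \<epsilon>\<^sup>2 * real N powr (\<delta> / 8)"
      by (simp add: powr_minus_divide)
    then have "measure (Q N) {\<omega> \<in> space (Q N). \<epsilon> < \<bar>fst \<omega> (proj N x) - snd \<omega> x\<bar>} \<le> 2 * ?e"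
      if "x \<in> box_lattice N \<delta>" for x
      using close[OF N _ that \<epsilon>] \<delta> by simp
    from level_sets_sandwiched_prob[OF N Q[OF N] _ this]
    have "1 - real N ^ CARD('d) * (2 * ?e) \<le> measure (Q N) (S N \<delta> \<epsilon> h)"
      by (simp add: S_def)
    moreover have "0 \<le> real N ^ CARD('d) * ?e" by simp
    ultimately show ?thesis by linarith
  qed
  have lim: "(\<lambda>N. measure (Q N) (S N \<delta> \<epsilon> h)) \<longlonglongrightarrow> 1"
    if \<delta>: "\<delta> \<in> {1/2<..<1}" and \<epsilon>: "\<epsilon> > 0" for \<delta> \<epsilon> h
  proof (rule tendsto_sandwich)
    define a where "a = (1 / (2 * v)) * \<epsilon>\<^sup>2"
    define b where "b = \<delta> / 8"
    have ab: "0 < a" "0 < b" using v \<epsilon> \<delta> by (auto simp: a_def b_def)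
    have "(\<lambda>N :: nat. 1 - 4 * real N powr CARD('d) * exp (- (a * real N powr b))) \<longlonglongrightarrow> 1"
      using ab by real_asymp
    moreover have "eventually (\<lambda>N :: nat. 1 - 4 * real N powr CARD('d) * exp (- (a * real N powr b))
        = 1 - 4 * real N ^ CARD('d) * exp (- (1 / (2 * v)) * \<epsilon>\<^sup>2 * real N powr (\<delta> / 8))) sequentially"
      using eventually_gt_at_top[of 0]
      by eventually_elim (simp add: powr_realpow a_def b_def)
    ultimately show "(\<lambda>N. 1 - 4 * real N ^ CARD('d) * exp (- (1 / (2 * v)) * \<epsilon>\<^sup>2 * real N powr (\<delta> / 8))) \<longlonglongrightarrow> 1"
      by (rule Lim_transform_eventually)
    show "eventually (\<lambda>N. 1 - 4 * real N ^ CARD('d) * exp (- (1 / (2 * v)) * \<epsilon>\<^sup>2 * real N powr (\<delta> / 8))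
        \<le> measure (Q N) (S N \<delta> \<epsilon> h)) sequentially"
      using eventually_ge_at_top[of 1] by eventually_elim (rule bound[OF _ \<delta> \<epsilon>])
    show "eventually (\<lambda>N. measure (Q N) (S N \<delta> \<epsilon> h) \<le> 1) sequentially"
      using eventually_ge_at_top[of 1]
    proof eventually_elim
      case (elim N)
      then have "prob_space (Q N)"
        using Q by (simp add: GFF_coupling_def centered_gaussian_field_def)
      then show ?case by (rule prob_space.prob_le_1)
    qed
  qed (rule tendsto_const)
  show ?thesis
  proof (intro exI[of _ Q] conjI ballI allI impI)
    show "GFF_coupling N (Q N)" if "1 \<le> N" for N using Q that by simp
  next
    fix \<delta> :: real assume \<delta>: "\<delta> \<in> {1/2<..<1}"
    then have "0 < 1 / (2 * v)" "0 < \<delta> / 8" using v by auto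
    then show "\<exists>c>0. \<exists>c'>0. \<forall>\<epsilon>>0. \<forall>h. \<forall>N\<ge>1.
       measure (Q N) {\<omega> \<in> space (Q N). level_sets_sandwiched N \<delta> \<epsilon> h (fst \<omega>) (snd \<omega>)}
         \<ge> 1 - 4 * real N ^ CARD('d) * exp (- c * \<epsilon>\<^sup>2 * real N powr c')"
      using bound[OF _ \<delta>] unfolding S_def by blast
  next
    show "(\<lambda>N. measure (Q N) {\<omega> \<in> space (Q N). level_sets_sandwiched N \<delta> \<epsilon> h (fst \<omega>) (snd \<omega>)}) \<longlonglongrightarrow> 1"
      if "\<delta> \<in> {1/2<..<1}" "0 < \<epsilon>" for \<delta> \<epsilon> h
      using lim[OF that, of h] by (simp add: S_def)
  qed
qed

end
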